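(* Let $X\subseteq\mathbb{R}^d$ be a convex set containing the $\ell_\infty$ ball $\{x:\|x\|_\infty\le r\}$ of radius $r$ for some $r>0$. Let $p\ge1$ and $1/p+1/q=1$, let $G\in(0,\infty)$, and let $\mathcal C$ be the set of convex functions that are $G$-Lipschitz continuous with respect to the $\ell_q$-norm over $X$. For $p\in[1,2]$ and any $\tau\in\{1,2,\dots\}$, the minimax oracle complexity satisfies $$\epsilon_T^*(\mathcal C,X,\tau,G,p)=\Omega\Big(Gr\sqrt d\,\sqrt{\tfrac{\tau}{T}}\Big).$$ For $p\in[2,\infty]$ and any $\tau\in\{1,2,\dots\}$, it satisfies $$\epsilon_T^*(\mathcal C,X,\tau,G,p)=\Omega\Big(Gr\,d^{1/q}\sqrt{\tfrac{\tau}{T}}\Big).$$ Here $a_T=\Omega(b_T)$ means: there are a numerical constant $c>0$ (not depending on $T,\tau,d,G,r,p,X$) and $N<\infty$ (which may depend on the parameters other than $T$) such that $a_T\ge c\,b_T$ for all $T\ge N$.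
   Context: Oracle model. An oracle is a pair $\mathcal O=(P,\mathsf g)$ where $P$ is the law of a stochastic process $\xi_1,\xi_2,\dots$ in a measurable sample space $\Xi$ and $\mathsf g:X\times\Xi\to\mathbb{R}^d$ is measurable. When queried at $x\in X$ at time $t$ (the $t$-th query), the oracle draws $\xi_t$ from $P(\cdot\mid\xi_1,\dots,\xi_{t-1})$ and returns $\mathsf g(x;\xi_t)$. A method $\mathcal M$ issues queries $x(1),x(2),\dots\in X$, where $x(t+1)$ may depend on $\mathsf g(x(1);\xi_1),\dots,\mathsf g(x(t);\xi_t)$, and after $T$ queries outputs an estimate $\widehat x\in X$ of the minimizer of $f$, which is a function of $\mathsf g(x(1);\xi_1),\dots,\mathsf g(x(T);\xi_T)$. Its error is $\epsilon_T(\mathcal M,f,X,\mathcal O)=f(\widehat x)-\inf_{x\in X}f(x)$. Let $d_{\mathrm{TV}}(P,Q)=\int|p-q|\,d\mu$ for probability measures with densities $p,q$ with respect to $\mu$, and let $P^{t'}_{[t]}$ be the conditional distribution of $\xi_{t'}$ given $\sigma(\xi_1,\dots,\xi_t)$. For $f$ convex, $\tau\in\mathbb{N}$, $G\in(0,\infty)$, $p\in[1,\infty]$, the admissible oracle set $\mathcal Q(f,\tau,G,p)$ is the set of oracles $\mathcal O=(P,\mathsf g)$ for which there exists a probability distribution $\Pi$ on $\Xi$ such that: $\|\mathsf g(x;\xi)\|_p\le G$ for all $x\in X$, $\xi\in\Xi$; $\mathbb{E}_\Pi[\mathsf g(x;\xi)]\in\partial f(x)$ for all $x\in X$; and $d_{\mathrm{TV}}(P^{t+\tau}_{[t]},\Pi)=0$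 for all $t\in\mathbb{N}$ with probability 1. The minimax error is $$\epsilon_T^*(\mathcal C,X,\tau,G,p)=\inf_{\mathcal M}\ \sup_{f\in\mathcal C}\ \sup_{\mathcal O\in\mathcal Q(f,\tau,G,p)}\mathbb{E}_{\mathcal O}\big[\epsilon_T(\mathcal M,f,X,\mathcal O)\big],$$ the expectation being over the randomness in $\mathcal O$. *)

theory Defs
  imports "HOL-Probability.Probability" "HOL-Library.Function_Algebras"
begin

section \<open>Euclidean space of variable dimension\<close>

text \<open>
  The constant in the lower bound has to be chosen before the dimension \<open>d\<close>, so \<open>d\<close> is a
  natural number and not the cardinality of a type.  A vector of dimension \<open>d\<close> is a function
  \<open>nat \<Rightarrow> real\<close> that vanishes outside \<open>{..<d}\<close>.  With the pointwise vector space structure below,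
  the library notions \<^const>\<open>convex\<close> and \<^const>\<open>convex_on\<close> apply to such vectors.  The Borel sets of
  \<open>nat \<Rightarrow> real\<close> (product topology) induce the usual Borel sets on \<open>rvec d\<close>.
\<close>

instantiation "fun" :: (type, real_vector) real_vector
begin

definition scaleR_fun :: "real \<Rightarrow> ('a \<Rightarrow> 'b) \<Rightarrow> 'a \<Rightarrow> 'b" where
  "scaleR_fun c f = (\<lambda>x. c *\<^sub>R f x)"

instance
  by standard (simp_all add: scaleR_fun_def fun_eq_iff scaleR_add_left scaleR_add_right)

end

lemma scaleR_fun_apply [simp]: "(c *\<^sub>R f) x = c *\<^sub>R f x"
  by (simp add: scaleR_fun_def)

type_synonym rvector = "nat \<Rightarrow> real"

definition rvec :: "nat \<Rightarrow> rvector set" where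
  "rvec d = {x. \<forall>i\<ge>d. x i = 0}"

lemma convex_rvec: "convex (rvec d)"
  by (auto simp: rvec_def convex_def)

definition lp_norm :: "nat \<Rightarrow> ennreal \<Rightarrow> rvector \<Rightarrow> real" where
  "lp_norm d p x =
     (if p = \<infinity> then (MAX i\<in>{..<d}. \<bar>x i\<bar>)
      else (\<Sum>i<d. \<bar>x i\<bar> powr enn2real p) powr (1 / enn2real p))"

definition subdifferential :: "nat \<Rightarrow> (rvector \<Rightarrow> real) \<Rightarrow> rvector \<Rightarrow> rvector set" where
  "subdifferential d f x =
     {v \<in> rvec d. \<forall>y\<in>rvec d. f y \<ge> f x + (\<Sum>i<d. v i * (y i - x i))}"

text \<open>Lipschitz continuity is required on \<open>X\<close> only; convexity is that of a function on the whole space.\<close>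

definition convex_lipschitz :: "nat \<Rightarrow> rvector set \<Rightarrow> real \<Rightarrow> ennreal \<Rightarrow> (rvector \<Rightarrow> real) set" where
  "convex_lipschitz d X G q =
     {f. convex_on (rvec d) f \<and> (\<forall>x\<in>X. \<forall>y\<in>X. \<bar>f x - f y\<bar> \<le> G * lp_norm d q (x - y))}"


section \<open>Total variation\<close>

text \<open>
  The \<open>L\<^sub>1\<close> distance of the densities (without the factor \<open>1/2\<close>), computed with the dominating
  measure \<open>sup P Q\<close>; the lemma \<open>tv_dist_density\<close> shows that the choice of dominating measure and
  densities is immaterial.
\<close>

definition tv_dist :: "'a measure \<Rightarrow> 'a measure \<Rightarrow> real" where
  "tv_dist P Q =
     (\<integral>x. \<bar>enn2real (RN_deriv (sup P Q) P x) - enn2real (RN_deriv (sup P Q) Q x)\<bar> \<partial>sup P Q)"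

lemma sup_density:
  fixes p q :: "'a \<Rightarrow> ennreal"
  assumes [measurable]: "p \<in> borel_measurable M" "q \<in> borel_measurable M"
  shows "sup (density M p) (density M q) = density M (\<lambda>x. max (p x) (q x))" (is "?S = ?D")
proof (rule antisym)
  have "density M p \<le> ?D" "density M q \<le> ?D"
    by (auto simp: le_measure emeasure_density intro!: nn_integral_mono mult_right_mono)
  then show "?S \<le> ?D" by (rule sup_least)
next
  have sS [simp]: "sets ?S = sets M"
    by (simp add: sets_sup)
  have "density M p \<le> ?S" "density M q \<le> ?S"
    by simp_all
  then have leS: "emeasure (density M p) X \<le> emeasure ?S X"
                 "emeasure (density M q) X \<le> emeasure ?S X"
    if "X \<in> sets M" for X
    using that
    by (simp_all only: le_measure[OF sets_density[THEN trans, OF sS[symmetric]]] sets_density)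
  have "emeasure ?D X \<le> emeasure ?S X" if [measurable]: "X \<in> sets M" for X
  proof -
    define A where "A = {x \<in> space M. q x \<le> p x}"
    have [measurable]: "A \<in> sets M" unfolding A_def by measurable
    have "emeasure ?D X = emeasure ?D (X \<inter> A) + emeasure ?D (X - A)"
      by (subst plus_emeasure) (auto intro!: arg_cong[where f = "emeasure ?D"])
    also have "emeasure ?D (X \<inter> A) = emeasure (density M p) (X \<inter> A)"
      by (auto simp: emeasure_density A_def max_def indicator_def intro!: nn_integral_cong)
    also have "emeasure ?D (X - A) = emeasure (density M q) (X - A)"
      by (auto simp: emeasure_density A_def max_def indicator_def intro!: nn_integral_cong)
    also have "emeasure (density M p) (X \<inter> A) + emeasure (density M q) (X - A)
               \<le> emeasure ?S (X \<inter> A) + emeasure ?S (X - A)"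
      by (intro add_mono leS) auto
    also have "\<dots> = emeasure ?S X"
      by (subst plus_emeasure) (auto intro!: arg_cong[where f = "emeasure ?S"])
    finally show ?thesis .
  qed
  then show "?D \<le> ?S"
    by (subst le_measure) (auto simp: sS)
qed

lemma tv_dist_density:
  fixes p q :: "'a \<Rightarrow> real"
  assumes [measurable]: "p \<in> borel_measurable M" "q \<in> borel_measurable M"
    and nonneg: "\<And>x. x \<in> space M \<Longrightarrow> 0 \<le> p x" "\<And>x. x \<in> space M \<Longrightarrow> 0 \<le> q x"
    and prob: "prob_space (density M p)" "prob_space (density M q)"
  shows "tv_dist (density M p) (density M q) = (\<integral>x. \<bar>p x - q x\<bar> \<partial>M)"
proof -
  define m where "m = (\<lambda>x. max (p x) (q x))"
  have [measurable]: "m \<in> borel_measurable M" unfolding m_def by measurable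
  have m0: "0 \<le> m x" if "x \<in> space M" for x using nonneg[OF that] by (simp add: m_def)
  let ?D = "density M m"
  have S: "sup (density M p) (density M q) = ?D"
    by (subst sup_density) (auto simp: m_def max_def ennreal_leI intro!: density_cong AE_I2
      intro: antisym ennreal_leI)
  have quot: "density ?D (\<lambda>x. ennreal (h x / m x)) = density M h"
    if [measurable]: "h \<in> borel_measurable M"
      and h: "\<And>x. x \<in> space M \<Longrightarrow> 0 \<le> h x" "\<And>x. x \<in> space M \<Longrightarrow> h x \<le> m x" for h
  proof -
    have "ennreal (m x) * ennreal (h x / m x) = ennreal (h x)" if "x \<in> space M" for x
      using h[OF that] m0[OF that] by (cases "m x = 0") (auto simp flip: ennreal_mult')
    then show ?thesis
      by (subst density_density_eq) (auto intro!: density_cong AE_I2)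
  qed
  have RN: "AE x in ?D. RN_deriv ?D (density M h) x = ennreal (h x / m x)"
    if hm [measurable]: "h \<in> borel_measurable M"
      and h: "\<And>x. x \<in> space M \<Longrightarrow> 0 \<le> h x" "\<And>x. x \<in> space M \<Longrightarrow> h x \<le> m x"
      and "prob_space (density M h)" for h
  proof -
    interpret H: prob_space "density M h" by fact
    have "AE x in ?D. ennreal (h x / m x) = RN_deriv ?D (density M h) x"
      by (rule RN_deriv_unique_sigma_finite)
         (use quot[OF hm h] in \<open>auto intro: H.sigma_finite_measure_axioms\<close>)
    then show ?thesis by eventually_elim simp
  qed
  have "AE x in ?D. RN_deriv ?D (density M p) x = ennreal (p x / m x)"
       "AE x in ?D. RN_deriv ?D (density M q) x = ennreal (q x / m x)"
    by (rule RN; use nonneg prob in \<open>simp add: m_def\<close>)+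
  then have "AE x in ?D. \<bar>enn2real (RN_deriv ?D (density M p) x) - enn2real (RN_deriv ?D (density M q) x)\<bar>
      = \<bar>p x / m x - q x / m x\<bar>"
    using AE_space by eventually_elim (use nonneg m0 in \<open>simp add: divide_nonneg_nonneg\<close>)
  then have "tv_dist (density M p) (density M q) = (\<integral>x. \<bar>p x / m x - q x / m x\<bar> \<partial>?D)"
    unfolding tv_dist_def S by (intro integral_cong_AE) measurable
  also have "\<dots> = (\<integral>x. m x * \<bar>p x / m x - q x / m x\<bar> \<partial>M)"
    using m0 by (subst integral_density) (auto intro!: AE_I2)
  also have "\<dots> = (\<integral>x. \<bar>p x - q x\<bar> \<partial>M)"
  proof (rule Bochner_Integration.integral_cong)
    fix x assume x: "x \<in> space M"
    show "m x * \<bar>p x / m x - q x / m x\<bar> = \<bar>p x - q x\<bar>"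
    proof (cases "m x = 0")
      case True
      then have "p x = 0" "q x = 0" using nonneg[OF x] by (auto simp: m_def max_def split: if_splits)
      then show ?thesis by simp
    next
      case False
      with m0[OF x] show ?thesis
        by (simp add: diff_divide_distrib[symmetric] abs_divide)
    qed
  qed simp
  finally show ?thesis .
qed


section \<open>Stochastic first-order query model\<close>

text \<open>
  The process \<open>\<xi>\<^sub>1, \<xi>\<^sub>2, \<dots>\<close> is the coordinate process on the product space indexed by \<open>{1..}\<close>, and
  \<open>law\<close> is its distribution.
\<close>

record 'x stoch_oracle =
  sample_space :: "'x measure"
  law :: "(nat \<Rightarrow> 'x) measure"
  grad :: "rvector \<Rightarrow> 'x \<Rightarrow> rvector"

definition is_stoch_oracle :: "nat \<Rightarrow> rvector set \<Rightarrow> 'x stoch_oracle \<Rightarrow> bool" where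
  "is_stoch_oracle d X Q \<longleftrightarrow>
     prob_space (law Q) \<and>
     sets (law Q) = sets (PiM {1..} (\<lambda>_. sample_space Q)) \<and>
     (\<forall>x\<in>X. \<forall>s\<in>space (sample_space Q). grad Q x s \<in> rvec d) \<and>
     (\<lambda>(x, s). grad Q x s) \<in> restrict_space borel X \<Otimes>\<^sub>M sample_space Q \<rightarrow>\<^sub>M borel"

text \<open>The sigma-algebra generated by the first \<open>t\<close> samples (trivial for \<open>t = 0\<close>).\<close>

definition history :: "'x stoch_oracle \<Rightarrow> nat \<Rightarrow> (nat \<Rightarrow> 'x) measure" where
  "history Q t =
     vimage_algebra (space (law Q)) (\<lambda>\<omega>. restrict \<omega> {1..t}) (PiM {1..t} (\<lambda>_. sample_space Q))"

text \<open>
  \<open>K\<close> is a regular version of the conditional distribution of the sample with index \<open>t'\<close> given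
  the first \<open>t\<close> samples.
\<close>

definition is_cond_distr ::
    "'x stoch_oracle \<Rightarrow> nat \<Rightarrow> nat \<Rightarrow> ((nat \<Rightarrow> 'x) \<Rightarrow> 'x measure) \<Rightarrow> bool" where
  "is_cond_distr Q t t' K \<longleftrightarrow>
     K \<in> history Q t \<rightarrow>\<^sub>M prob_algebra (sample_space Q) \<and>
     (\<forall>A\<in>sets (sample_space Q). AE \<omega> in law Q.
        measure (K \<omega>) A =
        real_cond_exp (law Q) (history Q t) (indicator {\<omega>' \<in> space (law Q). \<omega>' t' \<in> A}) \<omega>)"

definition admissible ::
    "nat \<Rightarrow> rvector set \<Rightarrow> (rvector \<Rightarrow> real) \<Rightarrow> nat \<Rightarrow> real \<Rightarrow> ennreal \<Rightarrow> 'x stoch_oracle set" where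
  "admissible d X f \<tau> G p =
     {Q. is_stoch_oracle d X Q \<and>
         (\<exists>D. prob_space D \<and> sets D = sets (sample_space Q) \<and>
            (\<forall>x\<in>X. \<forall>s\<in>space (sample_space Q). lp_norm d p (grad Q x s) \<le> G) \<and>
            (\<forall>x\<in>X. (\<lambda>i. \<integral>s. grad Q x s i \<partial>D) \<in> subdifferential d f x) \<and>
            (\<exists>K. (\<forall>t. is_cond_distr Q t (t + \<tau>) (K t)) \<and>
                 (AE \<omega> in law Q. \<forall>t. tv_dist (K t \<omega>) D = 0)))}"

text \<open>
  The argument of \<open>query\<close> and \<open>estimate\<close> is the list of answers received so far, oldest first.
\<close>

record strategy =
  query :: "rvector list \<Rightarrow> rvector"
  estimate :: "rvector list \<Rightarrow> rvector"

definition strategies :: "rvector set \<Rightarrow> strategy set" where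
  "strategies X = {M. (\<forall>h. query M h \<in> X) \<and> (\<forall>h. estimate M h \<in> X)}"

primrec answers :: "strategy \<Rightarrow> 'x stoch_oracle \<Rightarrow> (nat \<Rightarrow> 'x) \<Rightarrow> nat \<Rightarrow> rvector list" where
  "answers M Q \<omega> 0 = []"
| "answers M Q \<omega> (Suc t) =
     (let h = answers M Q \<omega> t in h @ [grad Q (query M h) (\<omega> (Suc t))])"

text \<open>
  The set \<open>X\<close> may be unbounded and \<open>f\<close> unbounded below on it, so the infimum and the error are
  extended reals.
\<close>

definition opt_gap :: "rvector set \<Rightarrow> (rvector \<Rightarrow> real) \<Rightarrow> rvector \<Rightarrow> ereal" where
  "opt_gap X f x = ereal (f x) - (INF y\<in>X. ereal (f y))"

text \<open>
  No measurability is imposed on strategies.  The error is nonnegative, and its expectation is the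
  Lebesgue integral of a nonnegative function, which the library defines for every function (as the
  lower integral if the function is not measurable).
\<close>

definition expected_error ::
    "strategy \<Rightarrow> (rvector \<Rightarrow> real) \<Rightarrow> rvector set \<Rightarrow> 'x stoch_oracle \<Rightarrow> nat \<Rightarrow> ennreal" where
  "expected_error M f X Q T =
     (\<integral>\<^sup>+\<omega>. e2ennreal (opt_gap X f (estimate M (answers M Q \<omega> T))) \<partial>law Q)"

text \<open>
  Sample spaces range over all measurable spaces on subsets of the sequence space \<open>nat \<Rightarrow> real\<close>;
  up to isomorphism these include all standard Borel spaces.
\<close>

definition minimax_error ::
    "(rvector \<Rightarrow> real) set \<Rightarrow> nat \<Rightarrow> rvector set \<Rightarrow> nat \<Rightarrow> real \<Rightarrow> ennreal \<Rightarrow> nat \<Rightarrow> ennreal" where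
  "minimax_error C d X \<tau> G p T =
     (INF M\<in>strategies X. SUP f\<in>C.
        SUP Q\<in>(admissible d X f \<tau> G p :: (nat \<Rightarrow> real) stoch_oracle set). expected_error M f X Q T)"

end

theory Submission
  imports Defs
begin

text \<open>
  Assouad's method with a process that is constant on blocks of length \<open>\<tau>\<close>: then \<open>\<xi>\<^sub>t\<^sub>+\<^sub>\<tau>\<close> is
  independent of \<open>\<xi>\<^sub>1, \<dots>, \<xi>\<^sub>t\<close>, but \<open>T\<close> queries reveal only \<open>n = \<lceil>T / \<tau>\<rceil>\<close> independent samples.
  For \<open>v \<in> {-1, 1}\<^sup>d\<close> a sample is a vector \<open>s\<close> with entries in \<open>{-1, 0, 1}\<close>, each coordinate being
  nonzero with probability \<open>\<rho>\<close> and then equal to \<open>v\<^sub>i\<close> with probability \<open>(1 + \<epsilon>) / 2\<close>, and the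
  objective is the mean of \<open>A \<Sum>\<^sub>i \<bar>s\<^sub>i\<bar> \<bar>x\<^sub>i - r s\<^sub>i\<bar>\<close>.  Its minimizer is \<open>r v\<close>, and every coordinate
  with the wrong sign costs at least \<open>A \<rho> r \<epsilon>\<close>.  Flipping one \<open>v\<^sub>i\<close> changes the law of one sample so
  little that the Hellinger affinity is at least \<open>1 - \<rho> \<epsilon>\<^sup>2\<close>; with \<open>\<epsilon>\<^sup>2 = 1 / (4 n \<rho>)\<close> the two laws
  of \<open>n\<close> samples stay indistinguishable, so a constant fraction of the \<open>d\<close> signs is missed.
  For independent coordinates \<open>\<rho> = 1\<close> and the bound on the gradients allows \<open>A = G d\<^sup>-\<^sup>1\<^sup>/\<^sup>p\<close>; for
  samples with a single nonzero coordinate, chosen uniformly, \<open>\<rho> = 1/d\<close> and \<open>A = G\<close>.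
\<close>

section \<open>Block-constant processes\<close>

text \<open>Samples are numbered from 1 and blocks from 0, hence \<open>(t - 1) div \<tau>\<close>;
  \<open>\<eta>\<close> is the i.i.d. sequence of block values.\<close>

definition block_law :: "nat \<Rightarrow> 'x measure \<Rightarrow> (nat \<Rightarrow> 'x) measure" where
  "block_law \<tau> D =
     distr (PiM UNIV (\<lambda>_. D)) (PiM {1..} (\<lambda>_. D)) (\<lambda>\<eta>. \<lambda>t\<in>{1..}. \<eta> ((t - 1) div \<tau>))"

lemma block_measurable [measurable]:
  "(\<lambda>\<eta>. \<lambda>t\<in>{1..}. \<eta> ((t - 1) div \<tau>)) \<in> PiM UNIV (\<lambda>_. D) \<rightarrow>\<^sub>M PiM {1..} (\<lambda>_. D)"
  by (rule measurable_restrict) auto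

lemma sets_block_law [simp]: "sets (block_law \<tau> D) = sets (PiM {1..} (\<lambda>_. D))"
  and space_block_law [simp]: "space (block_law \<tau> D) = space (PiM {1..} (\<lambda>_. D))"
  by (simp_all add: block_law_def)

lemma prob_space_block_law:
  assumes "prob_space D"
  shows "prob_space (block_law \<tau> D)"
  unfolding block_law_def
  by (intro prob_space.prob_space_distr prob_space_PiM assms block_measurable)

lemma indep_vars_PiM_coordinates:
  assumes "prob_space D" "I \<noteq> {}"
  shows "prob_space.indep_vars (PiM I (\<lambda>_. D)) (\<lambda>_. D) (\<lambda>i \<omega>. \<omega> i) I"
proof -
  interpret prob_space "PiM I (\<lambda>_. D)" by (intro prob_space_PiM assms)
  show ?thesis
  proof (subst indep_vars_iff_distr_eq_PiM')
    have "distr (PiM I (\<lambda>_. D)) (PiM I (\<lambda>_. D)) (\<lambda>x. \<lambda>i\<in>I. x i) = distr (PiM I (\<lambda>_. D)) (PiM I (\<lambda>_. D)) (\<lambda>x. x)"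
      by (rule distr_cong) (auto simp: space_PiM)
    also have "\<dots> = PiM I (\<lambda>_. D)" by (rule distr_id)
    also have "\<dots> = (\<Pi>\<^sub>M i\<in>I. distr (PiM I (\<lambda>_. D)) D (\<lambda>\<omega>. \<omega> i))"
      by (intro PiM_cong) (use assms in \<open>simp_all add: distr_PiM_component[of I "\<lambda>_. D"]\<close>)
    finally show "distr (PiM I (\<lambda>_. D)) (PiM I (\<lambda>_. D)) (\<lambda>x. \<lambda>i\<in>I. x i) = \<dots>" .
  qed (use assms in auto)
qed

text \<open>The samples \<open>1, ..., t\<close> lie in blocks before that of sample
  \<open>t + \<tau>\<close>, so the two events depend on disjoint sets of coordinates of
  \<open>\<eta>\<close>. Conditioning on the history needs exactly this product formula.\<close>

lemma block_law_indep:
  assumes "prob_space D" "\<tau> \<ge> 1" and E [measurable]: "E \<in> sets (PiM {1..t} (\<lambda>_. D))"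
    and A [measurable]: "A \<in> sets D"
  shows "measure (block_law \<tau> D)
      {\<omega> \<in> space (block_law \<tau> D). restrict \<omega> {1..t} \<in> E \<and> \<omega> (t + \<tau>) \<in> A}
    = measure (block_law \<tau> D) {\<omega> \<in> space (block_law \<tau> D). restrict \<omega> {1..t} \<in> E} * measure D A"
proof -
  define P where "P = PiM (UNIV :: nat set) (\<lambda>_. D)"
  \<comment> \<open>\<open>k\<close> is the block of sample \<open>t + \<tau>\<close>. For
    \<open>t = 0\<close> it is block 0, and \<open>{..<k}\<close> is empty.\<close>
  define k where "k = (t + \<tau> - 1) div \<tau>"
  define b where "b = (\<lambda>\<eta> :: nat \<Rightarrow> 'a. \<lambda>t\<in>{1..}. \<eta> ((t - 1) div \<tau>))"
  define g where "g = (\<lambda>\<eta> :: nat \<Rightarrow> 'a. \<lambda>s\<in>{1..t}. \<eta> ((s - 1) div \<tau>))"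
  interpret prob_space P unfolding P_def by (intro prob_space_PiM assms)
  have b [measurable]: "b \<in> P \<rightarrow>\<^sub>M PiM {1..} (\<lambda>_. D)"
    unfolding b_def P_def by measurable
  have lt: "(s - 1) div \<tau> < k" if "s \<in> {1..t}" for s
  proof -
    have "s - 1 \<le> t - 1" using that by (intro diff_le_mono) simp
    then have "(s - 1) div \<tau> \<le> (t - 1) div \<tau>" by (rule div_le_mono)
    moreover have "k = (t - 1) div \<tau> + 1"
    proof -
      \<comment> \<open>Truncated subtraction makes this false for \<open>t = 0\<close>; the element
        \<open>s\<close> of \<open>{1..t}\<close> excludes that case.\<close>
      have "t + \<tau> - 1 = (t - 1) + \<tau>" using that by auto
      then have "k = ((t - 1) + \<tau>) div \<tau>" unfolding k_def by (rule arg_cong)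
      also have "\<dots> = (t - 1) div \<tau> + 1"
        by (rule div_add_self2) (use \<open>\<tau> \<ge> 1\<close> in linarith)
      finally show ?thesis .
    qed
    ultimately show ?thesis by simp
  qed
  have g [measurable]: "g \<in> PiM {..<k} (\<lambda>_. D) \<rightarrow>\<^sub>M PiM {1..t} (\<lambda>_. D)"
    unfolding g_def by (rule measurable_restrict) (use lt in auto)
  have comp [measurable]: "(\<lambda>\<omega>. \<omega> (t + \<tau>)) \<in> PiM {1..} (\<lambda>_. D) \<rightarrow>\<^sub>M D"
    by (rule measurable_component_singleton) (use \<open>\<tau> \<ge> 1\<close> in auto)
  have res [measurable]: "(\<lambda>\<omega>. restrict \<omega> {1..t}) \<in> PiM {1..} (\<lambda>_. D) \<rightarrow>\<^sub>M PiM {1..t} (\<lambda>_. D)"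
    by (rule measurable_restrict_subset) auto
  have gb: "restrict (b \<eta>) {1..t} = g (restrict \<eta> {..<k})" for \<eta>
    using lt by (auto simp: b_def g_def fun_eq_iff)
  have bk: "b \<eta> (t + \<tau>) = \<eta> k" for \<eta>
    using \<open>\<tau> \<ge> 1\<close> by (simp add: b_def k_def)
  have ind: "indep_vars (\<lambda>_. D) (\<lambda>i \<eta>. \<eta> i) UNIV"
    unfolding P_def by (rule indep_vars_PiM_coordinates) (use assms in auto)
  have iv: "indep_var (PiM {..<k} (\<lambda>_. D)) (\<lambda>\<eta>. restrict \<eta> {..<k}) (PiM {k} (\<lambda>_. D)) (\<lambda>\<eta>. restrict \<eta> {k})"
    using indep_var_restrict[OF ind, of "{..<k}" "{k}"] by simp
  define E' where "E' = g -` E \<inter> space (PiM {..<k} (\<lambda>_. D))"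
  define A' where "A' = (\<lambda>\<eta>. \<eta> k) -` A \<inter> space (PiM {k} (\<lambda>_. D))"
  have E': "E' \<in> sets (PiM {..<k} (\<lambda>_. D))" unfolding E'_def by measurable
  have A': "A' \<in> sets (PiM {k} (\<lambda>_. D))" unfolding A'_def
    by (rule measurable_sets[OF _ A]) (rule measurable_component_singleton, simp)
  have E'_iff: "restrict \<eta> {..<k} \<in> E' \<longleftrightarrow> restrict (b \<eta>) {1..t} \<in> E" if "\<eta> \<in> space P" for \<eta>
    unfolding E'_def gb using that by (auto simp: P_def space_PiM PiE_iff)
  have A'_iff: "restrict \<eta> {k} \<in> A' \<longleftrightarrow> b \<eta> (t + \<tau>) \<in> A" if "\<eta> \<in> space P" for \<eta>
    unfolding A'_def bk using that by (auto simp: P_def space_PiM PiE_iff)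
  have tr: "measure (block_law \<tau> D) {\<omega> \<in> space (block_law \<tau> D). R \<omega>} = measure P {\<eta> \<in> space P. R (b \<eta>)}"
    if "{\<omega> \<in> space (PiM {1..} (\<lambda>_. D)). R \<omega>} \<in> sets (PiM {1..} (\<lambda>_. D))" for R
  proof -
    have "block_law \<tau> D = distr P (PiM {1..} (\<lambda>_. D)) b"
      unfolding block_law_def P_def b_def ..
    then have "measure (block_law \<tau> D) {\<omega> \<in> space (block_law \<tau> D). R \<omega>}
        = measure P (b -` {\<omega> \<in> space (PiM {1..} (\<lambda>_. D)). R \<omega>} \<inter> space P)"
      using measure_distr[OF b that] by simp
    also have "b -` {\<omega> \<in> space (PiM {1..} (\<lambda>_. D)). R \<omega>} \<inter> space P = {\<eta> \<in> space P. R (b \<eta>)}"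
      using measurable_space[OF b] by auto
    finally show ?thesis .
  qed
  have meas: "measure (block_law \<tau> D) {\<omega> \<in> space (block_law \<tau> D). \<omega> (t + \<tau>) \<in> A} = measure D A"
  proof -
    have "measure (block_law \<tau> D) {\<omega> \<in> space (block_law \<tau> D). \<omega> (t + \<tau>) \<in> A}
        = measure P {\<eta> \<in> space P. b \<eta> (t + \<tau>) \<in> A}"
      by (rule tr) measurable
    also have "\<dots> = measure (distr P D (\<lambda>\<eta>. \<eta> k)) A"
      by (subst measure_distr) (auto simp: P_def bk intro!: arg_cong[where f = "measure _"])
    also have "\<dots> = measure D A"
      unfolding P_def by (subst distr_PiM_component) (use assms in auto)
    finally show ?thesis .
  qed
  have "measure (block_law \<tau> D)
      {\<omega> \<in> space (block_law \<tau> D). restrict \<omega> {1..t} \<in> E \<and> \<omega> (t + \<tau>) \<in> A}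
    = measure P {\<eta> \<in> space P. restrict (b \<eta>) {1..t} \<in> E \<and> b \<eta> (t + \<tau>) \<in> A}"
    by (rule tr) measurable
  also have "\<dots> = measure P {\<eta> \<in> space P. restrict (b \<eta>) {1..t} \<in> E}
      * measure P {\<eta> \<in> space P. b \<eta> (t + \<tau>) \<in> A}"
  proof -
    have "(\<lambda>\<eta>. (restrict \<eta> {..<k}, restrict \<eta> {k})) -` (E' \<times> A') \<inter> space P
        = {\<eta> \<in> space P. restrict (b \<eta>) {1..t} \<in> E \<and> b \<eta> (t + \<tau>) \<in> A}"
      "(\<lambda>\<eta>. restrict \<eta> {..<k}) -` E' \<inter> space P = {\<eta> \<in> space P. restrict (b \<eta>) {1..t} \<in> E}"
      "(\<lambda>\<eta>. restrict \<eta> {k}) -` A' \<inter> space P = {\<eta> \<in> space P. b \<eta> (t + \<tau>) \<in> A}"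
      using E'_iff A'_iff by blast+
    then show ?thesis using indep_varD[OF iv E' A'] by simp
  qed
  also have "measure P {\<eta> \<in> space P. restrict (b \<eta>) {1..t} \<in> E}
      = measure (block_law \<tau> D) {\<omega> \<in> space (block_law \<tau> D). restrict \<omega> {1..t} \<in> E}"
    by (rule tr[symmetric]) measurable
  also have "measure P {\<eta> \<in> space P. b \<eta> (t + \<tau>) \<in> A}
      = measure (block_law \<tau> D) {\<omega> \<in> space (block_law \<tau> D). \<omega> (t + \<tau>) \<in> A}"
    by (rule tr[symmetric]) measurable
  finally show ?thesis unfolding meas .
qed

text \<open>Sample \<open>t + \<tau>\<close> is independent of the history, so on every history
  event \<open>B\<close> the indicator of \<open>A\<close> integrates to \<open>measure D A\<close>
  times the mass of \<open>B\<close>. This characterizes the conditional expectation as a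
  constant.\<close>

lemma block_law_cond_distr:
  assumes D: "prob_space D" and "\<tau> \<ge> 1"
    and Q: "sample_space Q = D" "law Q = block_law \<tau> D"
  shows "is_cond_distr Q t (t + \<tau>) (\<lambda>_. D)"
  unfolding is_cond_distr_def
proof (intro conjI ballI)
  show "(\<lambda>_. D) \<in> history Q t \<rightarrow>\<^sub>M prob_algebra (sample_space Q)"
    by (rule measurable_const) (simp add: space_prob_algebra Q D)
next
  fix A assume "A \<in> sets (sample_space Q)"
  then have A [measurable]: "A \<in> sets D" by (simp add: Q)
  let ?L = "block_law \<tau> D"
  interpret L: prob_space ?L by (intro prob_space_block_law D)
  have res [measurable]: "(\<lambda>\<omega>. restrict \<omega> {1..t}) \<in> ?L \<rightarrow>\<^sub>M PiM {1..t} (\<lambda>_. D)"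
    using measurable_restrict_subset[of "{1..t}" "{1..}"]
    by (auto simp: measurable_cong_sets[OF sets_block_law refl])
  have comp [measurable]: "(\<lambda>\<omega>. \<omega> (t + \<tau>)) \<in> ?L \<rightarrow>\<^sub>M D"
    using measurable_component_singleton[of "t + \<tau>" "{1..}" "\<lambda>_. D"] \<open>\<tau> \<ge> 1\<close>
    by (auto simp: measurable_cong_sets[OF sets_block_law refl])
  have H: "history Q t = vimage_algebra (space ?L) (\<lambda>\<omega>. restrict \<omega> {1..t}) (PiM {1..t} (\<lambda>_. D))"
    by (simp add: history_def Q)
  \<comment> \<open>Every history event is a preimage under the restriction to
    \<open>{1..t}\<close>, the form that \<open>block_law_indep\<close> handles.\<close>
  have setsH: "sets (history Q t) =
      {(\<lambda>\<omega>. restrict \<omega> {1..t}) -` E \<inter> space ?L | E. E \<in> sets (PiM {1..t} (\<lambda>_. D))}"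
    unfolding H by (rule sets_vimage_algebra2) (use measurable_space[OF res] in auto)
  have sub: "subalgebra ?L (history Q t)"
    unfolding subalgebra_def setsH using measurable_sets[OF res] by (auto simp: H)
  interpret F: finite_measure_subalgebra ?L "history Q t"
    by unfold_locales (rule sub)
  let ?C = "{\<omega> \<in> space ?L. \<omega> (t + \<tau>) \<in> A}"
  have C [measurable]: "?C \<in> sets ?L" by measurable
  have int: "integrable ?L (indicat_real ?C)"
    by (rule integrable_real_indicator[OF C]) (simp add: L.emeasure_eq_measure)
  have "AE \<omega> in ?L. real_cond_exp ?L (history Q t) (indicator ?C) \<omega> = measure D A"
  proof (rule F.real_cond_exp_charact)
    fix B assume "B \<in> sets (history Q t)"
    then obtain E where E [measurable]: "E \<in> sets (PiM {1..t} (\<lambda>_. D))"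
      and B: "B = {\<omega> \<in> space ?L. restrict \<omega> {1..t} \<in> E}"
      unfolding setsH by auto
    have [measurable]: "B \<in> sets ?L" unfolding B by measurable
    have "(\<integral>\<omega>\<in>B. indicator ?C \<omega> \<partial>?L) = measure ?L (B \<inter> ?C)"
    proof -
      have "(\<integral>\<omega>\<in>B. indicator ?C \<omega> \<partial>?L) = (\<integral>\<omega>. indicator (B \<inter> ?C) \<omega> \<partial>?L)"
        by (auto simp: set_lebesgue_integral_def indicator_def intro!: Bochner_Integration.integral_cong)
      also have "\<dots> = measure ?L (B \<inter> ?C \<inter> space ?L)"
        by (rule Bochner_Integration.integral_indicator)
      also have "B \<inter> ?C \<inter> space ?L = B \<inter> ?C" by auto
      finally show ?thesis .
    qed
    also have "B \<inter> ?C = {\<omega> \<in> space ?L. restrict \<omega> {1..t} \<in> E \<and> \<omega> (t + \<tau>) \<in> A}"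
      unfolding B by auto
    also have "measure ?L \<dots> = measure ?L B * measure D A"
      unfolding B by (rule block_law_indep[OF D \<open>\<tau> \<ge> 1\<close> E A])
    also have "\<dots> = (\<integral>\<omega>\<in>B. measure D A \<partial>?L)"
      using sets.sets_into_space[OF \<open>B \<in> sets ?L\<close>]
      by (simp add: set_lebesgue_integral_def Int_absorb2)
    finally show "(\<integral>\<omega>\<in>B. indicator ?C \<omega> \<partial>?L) = (\<integral>\<omega>\<in>B. measure D A \<partial>?L)" .
  qed (use int in simp_all)
  then show "AE \<omega> in law Q. measure D A =
      real_cond_exp (law Q) (history Q t) (indicator {\<omega>' \<in> space (law Q). \<omega>' (t + \<tau>) \<in> A}) \<omega>"
    unfolding Q by eventually_elim simp
qed

lemma tv_dist_self [simp]: "tv_dist D D = 0"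
  by (simp add: tv_dist_def)

section \<open>Block processes with finitely supported samples\<close>

lemma prob_space_point_measure:
  fixes m :: "'x \<Rightarrow> real"
  assumes "finite S" "\<And>s. s \<in> S \<Longrightarrow> 0 \<le> m s" "(\<Sum>s\<in>S. m s) = 1"
  shows "prob_space (point_measure S m)"
  by (rule prob_spaceI) (use assms in \<open>simp add: emeasure_point_measure_finite space_point_measure sum_ennreal\<close>)

text \<open>No measurability of \<open>\<phi>\<close> is available, since strategies are arbitrary
  functions. A combination of indicators of cylinders, one for each possible block history
  \<open>h\<close>, lies below \<open>\<phi>\<close> and gives the direction that a lower bound
  needs.\<close>

lemma nn_integral_block_law_ge:
  fixes m :: "'x \<Rightarrow> real" and \<phi> :: "(nat \<Rightarrow> 'x) \<Rightarrow> ennreal"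
  assumes S: "finite S" and m: "\<And>s. s \<in> S \<Longrightarrow> 0 \<le> m s" "(\<Sum>s\<in>S. m s) = 1"
    and "\<tau> \<ge> 1" "T \<ge> 1" and n: "n = (T - 1) div \<tau> + 1"
    and \<phi>: "\<And>\<omega> \<omega>'. (\<And>t. t \<in> {1..T} \<Longrightarrow> \<omega> t = \<omega>' t) \<Longrightarrow> \<phi> \<omega> = \<phi> \<omega>'"
  shows "(\<Sum>h\<in>PiE {..<n} (\<lambda>_. S). ennreal (\<Prod>j<n. m (h j)) * \<phi> (\<lambda>t. h ((t - 1) div \<tau>)))
    \<le> (\<integral>\<^sup>+\<omega>. \<phi> \<omega> \<partial>block_law \<tau> (point_measure S m))"
proof -
  define D where "D = point_measure S m"
  have D: "prob_space D" unfolding D_def by (intro prob_space_point_measure assms) auto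
  define P where "P = PiM (UNIV :: nat set) (\<lambda>_. D)"
  define b where "b = (\<lambda>\<eta> :: nat \<Rightarrow> 'x. \<lambda>t\<in>{1..}. \<eta> ((t - 1) div \<tau>))"
  define L where "L = block_law \<tau> D"
  have sL: "sets L = sets (PiM {1..} (\<lambda>_. D))" unfolding L_def by simp
  have L: "L = distr P (PiM {1..} (\<lambda>_. D)) b" unfolding L_def block_law_def P_def b_def ..
  have b [measurable]: "b \<in> P \<rightarrow>\<^sub>M PiM {1..} (\<lambda>_. D)" unfolding b_def P_def by measurable
  have setsD: "sets D = Pow S" "space D = S" unfolding D_def by (auto simp: sets_point_measure space_point_measure)
  define H where "H = PiE {..<n} (\<lambda>_. S)"
  have finH: "finite H" unfolding H_def by (intro finite_PiE S) auto
  define C where "C h = {\<omega> \<in> space L. \<forall>t\<in>{1..T}. \<omega> t = h ((t - 1) div \<tau>)}" for h :: "nat \<Rightarrow> 'x"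
  have lt: "(t - 1) div \<tau> < n" if "t \<in> {1..T}" for t
    using that unfolding n by (auto simp: less_Suc_eq_le intro!: div_le_mono)
  \<comment> \<open>Block \<open>j\<close> starts at sample \<open>j * \<tau> + 1\<close>. All
    \<open>n\<close> blocks are therefore met by time \<open>T\<close>, and the first
    \<open>T\<close> samples determine \<open>h\<close>.\<close>
  have ex: "\<exists>t\<in>{1..T}. (t - 1) div \<tau> = j" if "j < n" for j
  proof (intro bexI)
    have "j * \<tau> \<le> (T - 1) div \<tau> * \<tau>" using that unfolding n by simp
    also have "\<dots> \<le> T - 1" by simp
    finally show "j * \<tau> + 1 \<in> {1..T}" using \<open>T \<ge> 1\<close> by simp
    show "(j * \<tau> + 1 - 1) div \<tau> = j" using \<open>\<tau> \<ge> 1\<close> by simp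
  qed
  have Cm [measurable]: "C h \<in> sets L" if "h \<in> H" for h
  proof -
    have "{\<omega> \<in> space (PiM {1..} (\<lambda>_. D)). \<forall>t\<in>{1..T}. \<omega> t \<in> {h ((t - 1) div \<tau>)}} \<in> sets (PiM {1..} (\<lambda>_. D))"
    proof (rule sets.sets_Collect_finite_All')
      fix t assume t: "t \<in> {1..T}"
      have [measurable]: "{h ((t - 1) div \<tau>)} \<in> sets D"
        using that lt[OF t] by (auto simp: H_def setsD)
      have [measurable]: "(\<lambda>\<omega>. \<omega> t) \<in> PiM {1..} (\<lambda>_. D) \<rightarrow>\<^sub>M D"
        by (rule measurable_component_singleton) (use t in auto)
      show "{\<omega> \<in> space (PiM {1..} (\<lambda>_. D)). \<omega> t \<in> {h ((t - 1) div \<tau>)}} \<in> sets (PiM {1..} (\<lambda>_. D))"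
        by measurable
    qed (use \<open>T \<ge> 1\<close> in auto)
    then show ?thesis unfolding C_def sL by (simp add: L)
  qed
  have emC: "emeasure L (C h) = ennreal (\<Prod>j<n. m (h j))" if h: "h \<in> H" for h
  proof -
    have "emeasure L (C h) = emeasure P (b -` C h \<inter> space P)"
      unfolding L by (rule emeasure_distr) (use Cm[OF h] sL b in auto)
    \<comment> \<open>In terms of the i.i.d. sequence the cylinder fixes exactly the first
      \<open>n\<close> coordinates, so its mass is a product.\<close>
    also have "b -` C h \<inter> space P = prod_emb UNIV (\<lambda>_. D) {..<n} (PiE {..<n} (\<lambda>j. {h j}))"
    proof -
      have "b \<eta> \<in> C h \<longleftrightarrow> (\<forall>j<n. \<eta> j = h j)" if "\<eta> \<in> space P" for \<eta>
      proof -
        have "b \<eta> \<in> C h \<longleftrightarrow> (\<forall>t\<in>{1..T}. \<eta> ((t - 1) div \<tau>) = h ((t - 1) div \<tau>))"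
          using measurable_space[OF b that] by (auto simp: C_def L b_def)
        also have "\<dots> \<longleftrightarrow> (\<forall>j<n. \<eta> j = h j)"
          using ex lt by metis
        finally show ?thesis .
      qed
      then show ?thesis
        by (auto simp: prod_emb_def P_def space_PiM PiE_iff)
    qed
    also have "emeasure P \<dots> = (\<Prod>j<n. emeasure D {h j})"
      unfolding P_def by (rule emeasure_PiM_emb) (use D h in \<open>auto simp: H_def setsD\<close>)
    also have "\<dots> = (\<Prod>j<n. ennreal (m (h j)))"
      unfolding D_def by (rule prod.cong) (use h S in \<open>auto simp: H_def emeasure_point_measure_finite PiE_iff\<close>)
    also have "\<dots> = ennreal (\<Prod>j<n. m (h j))"
      by (rule prod_ennreal) (use h m in \<open>auto simp: H_def PiE_iff\<close>)
    finally show ?thesis .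
  qed
  let ?c = "\<lambda>h. \<phi> (\<lambda>t. h ((t - 1) div \<tau>))"
  have "(\<Sum>h\<in>H. ennreal (\<Prod>j<n. m (h j)) * ?c h) = (\<Sum>h\<in>H. \<integral>\<^sup>+\<omega>. ?c h * indicator (C h) \<omega> \<partial>L)"
    by (intro sum.cong refl) (subst nn_integral_cmult_indicator, simp_all only: Cm emC mult.commute)
  also have "\<dots> = (\<integral>\<^sup>+\<omega>. (\<Sum>h\<in>H. ?c h * indicator (C h) \<omega>) \<partial>L)"
    by (rule nn_integral_sum[symmetric]) measurable
  also have "\<dots> \<le> (\<integral>\<^sup>+\<omega>. \<phi> \<omega> \<partial>L)"
  proof (rule nn_integral_mono)
    fix \<omega>
    show "(\<Sum>h\<in>H. ?c h * indicator (C h) \<omega>) \<le> \<phi> \<omega>"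
    proof (cases "\<exists>h\<in>H. \<omega> \<in> C h")
      case True
      then obtain h where h: "h \<in> H" "\<omega> \<in> C h" by blast
      have "h' = h" if h': "h' \<in> H" "\<omega> \<in> C h'" for h'
      proof (rule PiE_ext)
        fix j assume "j \<in> {..<n}"
        then show "h' j = h j" using ex[of j] h h' by (auto simp: C_def)
      qed (use h h' in \<open>auto simp: H_def\<close>)
      then have "\<forall>h'\<in>H - {h}. ?c h' * indicator (C h') \<omega> = 0"
        by (auto simp: indicator_def)
      then have "(\<Sum>h'\<in>H - {h}. ?c h' * indicator (C h') \<omega>) = 0"
        by (rule sum.neutral)
      then have "(\<Sum>h'\<in>H. ?c h' * indicator (C h') \<omega>) = ?c h * indicator (C h) \<omega>"
        by (subst sum.remove[OF finH h(1)]) simp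
      also have "?c h = \<phi> \<omega>"
        by (rule \<phi>) (use h in \<open>simp add: C_def\<close>)
      finally show ?thesis using h by simp
    next
      case False
      then show ?thesis by (simp add: sum.neutral)
    qed
  qed
  finally show ?thesis by (simp add: H_def L_def D_def)
qed

section \<open>Assouad's lower bound for a family of biased sign oracles\<close>

text \<open>
  Sign vectors are extensional, so they do not lie in \<open>rvec d\<close>; only coordinates below \<open>d\<close> are used.
\<close>

definition sign_vectors :: "nat \<Rightarrow> rvector set" where
  "sign_vectors d = PiE {..<d} (\<lambda>_. {-1, 1})"

lemma finite_sign_vectors [simp]: "finite (sign_vectors d)"
  unfolding sign_vectors_def by (intro finite_PiE) auto

lemma sign_vectors_cases: "v \<in> sign_vectors d \<Longrightarrow> i < d \<Longrightarrow> v i = -1 \<or> v i = 1"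
  by (auto simp: sign_vectors_def PiE_iff)

lemma bij_flip_sign_vectors:
  assumes "i < d"
  shows "bij_betw (\<lambda>v. v(i := - v i)) (sign_vectors d) (sign_vectors d)"
proof (rule bij_betw_byWitness[where f' = "\<lambda>v. v(i := - v i)"])
  have "v(i := - v i) \<in> sign_vectors d" if "v \<in> sign_vectors d" for v
    unfolding sign_vectors_def
  proof (rule PiE_I)
    fix j assume "j \<in> {..<d}"
    then show "(v(i := - v i)) j \<in> {-1, 1}" using sign_vectors_cases[OF that, of j] by auto
  next
    fix j assume "j \<notin> {..<d}"
    then show "(v(i := - v i)) j = undefined"
      using that assms PiE_arb[of v "{..<d}" _ j] by (auto simp: sign_vectors_def)
  qed
  then show "(\<lambda>v. v(i := - v i)) ` sign_vectors d \<subseteq> sign_vectors d"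
    "(\<lambda>v. v(i := - v i)) ` sign_vectors d \<subseteq> sign_vectors d" by blast+
qed simp_all

section \<open>Indistinguishability of two laws\<close>

text \<open>Le Cam's two-point bound: the sum of minima is the smallest possible total error of a
  test between \<open>a\<close> and \<open>b\<close>, and laws with affinity near 1 must overlap.
  For the sum m of the minima, the pointwise estimate gives 3/2 <= (3/2) m + 1, hence the constant
  1/3.\<close>

lemma sum_min_ge_of_affinity:
  fixes a b :: "'a \<Rightarrow> real"
  assumes "\<And>h. h \<in> H \<Longrightarrow> 0 \<le> a h" "\<And>h. h \<in> H \<Longrightarrow> 0 \<le> b h"
    and "(\<Sum>h\<in>H. a h) = 1" "(\<Sum>h\<in>H. b h) = 1" "(\<Sum>h\<in>H. sqrt (a h * b h)) \<ge> 3 / 4"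
  shows "(\<Sum>h\<in>H. min (a h) (b h)) \<ge> 1 / 3"
proof -
  \<comment> \<open>AM-GM for \<open>2 min a b\<close> and \<open>max a b / 2\<close>, then \<open>max a b = a + b - min a b\<close>\<close>
  have "2 * sqrt (a h * b h) \<le> 3 / 2 * min (a h) (b h) + (a h + b h) / 2" if "h \<in> H" for h
  proof -
    define x y where "x = sqrt (min (a h) (b h))" and "y = sqrt (max (a h) (b h))"
    have xy: "x^2 = min (a h) (b h)" "y^2 = max (a h) (b h)"
      using assms(1,2)[OF that] by (auto simp: x_def y_def)
    have "sqrt (a h * b h) = x * y"
      by (auto simp: x_def y_def min_def max_def real_sqrt_mult)
    moreover have "0 \<le> (2 * x - y)^2" by simp
    then have "4 * (x * y) \<le> 4 * x^2 + y^2" by (simp add: power2_eq_square algebra_simps)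
    moreover have "x^2 + y^2 = a h + b h" unfolding xy by simp
    ultimately have "2 * sqrt (a h * b h) \<le> 3 / 2 * x^2 + (a h + b h) / 2" by (simp add: field_simps)
    then show ?thesis unfolding xy .
  qed
  then have "(\<Sum>h\<in>H. 2 * sqrt (a h * b h)) \<le> (\<Sum>h\<in>H. 3 / 2 * min (a h) (b h) + (a h + b h) / 2)"
    by (rule sum_mono)
  then have "2 * (\<Sum>h\<in>H. sqrt (a h * b h)) \<le> 3 / 2 * (\<Sum>h\<in>H. min (a h) (b h)) + ((\<Sum>h\<in>H. a h) + (\<Sum>h\<in>H. b h)) / 2"
    by (simp add: sum.distrib sum_distrib_left flip: sum_divide_distrib)
  then show ?thesis using assms(3-5) by argo
qed

lemma sqrt_prod: "sqrt (prod f I) = (\<Prod>i\<in>I. sqrt (f i))"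
  by (induction I rule: infinite_finite_induct) (auto simp: real_sqrt_mult)

text \<open>The law of the oracle does not enter the answers. One function of the block history
  therefore serves for all \<open>v\<close>, and the error depends on the first \<open>T\<close>
  samples only.\<close>

lemma answers_cong:
  assumes "\<And>t. t \<in> {1..T} \<Longrightarrow> \<omega> t = \<omega>' t" "grad Q = grad Q'"
  shows "answers M Q \<omega> T = answers M Q' \<omega>' T"
  using assms(1)
proof (induction T)
  case (Suc T)
  then have "answers M Q \<omega> T = answers M Q' \<omega>' T" "\<omega> (Suc T) = \<omega>' (Suc T)" by simp_all
  then show ?case by (simp only: answers.simps assms(2))
qed simp

text \<open>
  \<open>m v\<close> is the mass function of one sample on \<open>S\<close>, \<open>\<rho>\<close> the probability that a given coordinate is
  nonzero, and \<open>\<epsilon>\<close> the bias of a nonzero coordinate \<open>i\<close> towards \<open>v i\<close>.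
\<close>

locale hard_instance =
  fixes d :: nat and X :: "rvector set" and S :: "rvector set"
    and m :: "rvector \<Rightarrow> rvector \<Rightarrow> real" and \<rho> \<epsilon> A r G :: real and p q :: ennreal
  assumes d: "d \<ge> 1" and r: "r > 0" and X: "X \<subseteq> rvec d" "{x \<in> rvec d. lp_norm d \<infinity> x \<le> r} \<subseteq> X"
    and \<rho>: "\<rho> \<ge> 0" and \<epsilon>: "0 \<le> \<epsilon>" "\<epsilon> \<le> 1" and A: "A \<ge> 0"
    and finite_S: "finite S"
    and m_nonneg: "\<And>v s. v \<in> sign_vectors d \<Longrightarrow> s \<in> S \<Longrightarrow> 0 \<le> m v s"
    and m_sum: "\<And>v. v \<in> sign_vectors d \<Longrightarrow> (\<Sum>s\<in>S. m v s) = 1"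
    and m_marginal: "\<And>v i \<sigma>. v \<in> sign_vectors d \<Longrightarrow> i < d \<Longrightarrow> \<sigma> \<in> {-1, 1} \<Longrightarrow>
      (\<Sum>s\<in>S. if s i = \<sigma> then m v s else 0) = \<rho> * (1 + \<epsilon> * \<sigma> * v i) / 2"
    and m_affinity: "\<And>v i. v \<in> sign_vectors d \<Longrightarrow> i < d \<Longrightarrow>
      (\<Sum>s\<in>S. sqrt (m v s * m (v(i := - v i)) s)) \<ge> 1 - \<rho> * \<epsilon>^2"
    and lp_bound: "\<And>s g. s \<in> S \<Longrightarrow> (\<And>i. i < d \<Longrightarrow> \<bar>g i\<bar> \<le> (if s i = -1 \<or> s i = 1 then A else 0)) \<Longrightarrow> lp_norm d p g \<le> G"
    and lq_bound: "\<And>z. A * \<rho> * (\<Sum>i<d. \<bar>z i\<bar>) \<le> G * lp_norm d q z"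
begin

section \<open>Hard objectives and admissible oracles\<close>

text \<open>By \<open>m_marginal\<close> this is the mean of the random loss with terms
  \<open>A * \<bar>x i - r * s i\<bar>\<close> over the coordinates with \<open>s i = -1\<close> or
  \<open>s i = 1\<close>. Only the coordinate marginals enter, so both families of samples
  fit.\<close>

definition hard_fun :: "rvector \<Rightarrow> rvector \<Rightarrow> real" where
  "hard_fun v x = (\<Sum>i<d. A * \<rho> / 2 * ((1 + \<epsilon> * v i) * \<bar>x i - r\<bar> + (1 - \<epsilon> * v i) * \<bar>x i + r\<bar>))"

text \<open>A subgradient of the random loss; \<open>sgn 0 = 0\<close> is a valid choice at a kink.
  An entry can be nonzero only where the sample has entry 1 or -1, as \<open>lp_bound\<close>
  requires.\<close>

definition hard_grad :: "rvector \<Rightarrow> rvector \<Rightarrow> rvector" where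
  "hard_grad x s i = (if i < d then A * ((if s i = 1 then sgn (x i - r) else 0)
     + (if s i = -1 then sgn (x i + r) else 0)) else 0)"

definition hard_oracle :: "nat \<Rightarrow> rvector \<Rightarrow> rvector stoch_oracle" where
  "hard_oracle \<tau> v = \<lparr>sample_space = point_measure S (m v),
     law = block_law \<tau> (point_measure S (m v)), grad = hard_grad\<rparr>"

lemma weights:
  assumes "v \<in> sign_vectors d" "i < d"
  shows "1 + \<epsilon> * v i \<ge> 0" "1 - \<epsilon> * v i \<ge> 0"
  using sign_vectors_cases[OF assms] \<epsilon> by auto

text \<open>Each coordinate contributes a nonnegative combination of shifted absolute values whose
  two weights \<open>1 + \<epsilon> * v i\<close> and \<open>1 - \<epsilon> * v i\<close> sum to 2.
  Hence \<open>A * \<rho>\<close> is a Lipschitz constant for the l1 norm, which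
  \<open>lq_bound\<close> converts.\<close>

lemma hard_fun_convex_lipschitz:
  assumes v: "v \<in> sign_vectors d"
  shows "hard_fun v \<in> convex_lipschitz d X G q"
  unfolding convex_lipschitz_def
proof (intro CollectI conjI ballI)
  show "convex_on (rvec d) (hard_fun v)"
    unfolding convex_on_def
  proof (intro conjI convex_rvec ballI allI impI)
    fix x y :: rvector and u w :: real
    assume uw: "0 \<le> u" "0 \<le> w" "u + w = 1"
    have abs: "\<bar>u * a + w * b + c\<bar> \<le> u * \<bar>a + c\<bar> + w * \<bar>b + c\<bar>" for a b c :: real
    proof -
      have "u * a + w * b + c = u * (a + c) + w * (b + c)"
      proof -
        have "u * (a + c) + w * (b + c) = u * a + w * b + (u + w) * c"
          by (simp add: algebra_simps)
        then show ?thesis using uw(3) by simp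
      qed
      then show ?thesis
        using abs_triangle_ineq[of "u * (a + c)" "w * (b + c)"] uw by (simp add: abs_mult)
    qed
    have "hard_fun v (u *\<^sub>R x + w *\<^sub>R y) \<le>
      (\<Sum>i<d. A * \<rho> / 2 * ((1 + \<epsilon> * v i) * (u * \<bar>x i - r\<bar> + w * \<bar>y i - r\<bar>) + (1 - \<epsilon> * v i) * (u * \<bar>x i + r\<bar> + w * \<bar>y i + r\<bar>)))"
      unfolding hard_fun_def
    proof (intro sum_mono mult_left_mono add_mono)
      fix i assume "i \<in> {..<d}"
      then show "0 \<le> 1 + \<epsilon> * v i" "0 \<le> 1 - \<epsilon> * v i" using weights[OF v] by auto
      show "\<bar>(u *\<^sub>R x + w *\<^sub>R y) i - r\<bar> \<le> u * \<bar>x i - r\<bar> + w * \<bar>y i - r\<bar>"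
        using abs[of "x i" "y i" "- r"] by simp
      show "\<bar>(u *\<^sub>R x + w *\<^sub>R y) i + r\<bar> \<le> u * \<bar>x i + r\<bar> + w * \<bar>y i + r\<bar>"
        using abs[of "x i" "y i" r] by simp
    qed (use A \<rho> in simp)
    also have "\<dots> = u * hard_fun v x + w * hard_fun v y"
      unfolding hard_fun_def sum_distrib_left sum.distrib[symmetric]
      by (intro sum.cong refl) (simp add: algebra_simps)
    finally show "hard_fun v (u *\<^sub>R x + w *\<^sub>R y) \<le> u * hard_fun v x + w * hard_fun v y" .
  qed
next
  fix x y
  have diff: "hard_fun v x - hard_fun v y = (\<Sum>i<d. A * \<rho> / 2 * ((1 + \<epsilon> * v i) * (\<bar>x i - r\<bar> - \<bar>y i - r\<bar>) + (1 - \<epsilon> * v i) * (\<bar>x i + r\<bar> - \<bar>y i + r\<bar>)))"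
    unfolding hard_fun_def sum_subtractf[symmetric]
    by (intro sum.cong refl) (simp add: algebra_simps)
  have "\<bar>hard_fun v x - hard_fun v y\<bar> \<le> (\<Sum>i<d. A * \<rho> / 2 * ((1 + \<epsilon> * v i) * \<bar>x i - y i\<bar> + (1 - \<epsilon> * v i) * \<bar>x i - y i\<bar>))"
  unfolding diff
  proof (intro order.trans[OF sum_abs] sum_mono)
    fix i assume "i \<in> {..<d}"
    then have w: "1 + \<epsilon> * v i \<ge> 0" "1 - \<epsilon> * v i \<ge> 0" using weights[OF v] by auto
    have "\<bar>(1 + \<epsilon> * v i) * (\<bar>x i - r\<bar> - \<bar>y i - r\<bar>) + (1 - \<epsilon> * v i) * (\<bar>x i + r\<bar> - \<bar>y i + r\<bar>)\<bar>
        \<le> (1 + \<epsilon> * v i) * \<bar>x i - y i\<bar> + (1 - \<epsilon> * v i) * \<bar>x i - y i\<bar>"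
    proof (intro order.trans[OF abs_triangle_ineq] add_mono)
      show "\<bar>(1 + \<epsilon> * v i) * (\<bar>x i - r\<bar> - \<bar>y i - r\<bar>)\<bar> \<le> (1 + \<epsilon> * v i) * \<bar>x i - y i\<bar>"
        unfolding abs_mult abs_of_nonneg[OF w(1)] by (intro mult_left_mono w) auto
      show "\<bar>(1 - \<epsilon> * v i) * (\<bar>x i + r\<bar> - \<bar>y i + r\<bar>)\<bar> \<le> (1 - \<epsilon> * v i) * \<bar>x i - y i\<bar>"
        unfolding abs_mult abs_of_nonneg[OF w(2)] by (intro mult_left_mono w) auto
    qed
    then show "\<bar>A * \<rho> / 2 * ((1 + \<epsilon> * v i) * (\<bar>x i - r\<bar> - \<bar>y i - r\<bar>) + (1 - \<epsilon> * v i) * (\<bar>x i + r\<bar> - \<bar>y i + r\<bar>))\<bar>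
        \<le> A * \<rho> / 2 * ((1 + \<epsilon> * v i) * \<bar>x i - y i\<bar> + (1 - \<epsilon> * v i) * \<bar>x i - y i\<bar>)"
      unfolding abs_mult[of "A * \<rho> / 2"] using A \<rho> by (simp add: mult_left_mono)
  qed
  also have "\<dots> = A * \<rho> * (\<Sum>i<d. \<bar>(x - y) i\<bar>)"
  proof -
    have "(1 + w) * a + (1 - w) * a = 2 * a" for w a :: real
      by (simp add: distrib_right left_diff_distrib)
    then show ?thesis unfolding sum_distrib_left by (simp add: mult.assoc)
  qed
  also have "\<dots> \<le> G * lp_norm d q (x - y)" by (rule lq_bound)
  finally show "\<bar>hard_fun v x - hard_fun v y\<bar> \<le> G * lp_norm d q (x - y)" .
qed

lemma prob_space_samples: "v \<in> sign_vectors d \<Longrightarrow> prob_space (point_measure S (m v))"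
  by (intro prob_space_point_measure finite_S m_nonneg m_sum)

lemma integral_hard_grad:
  assumes v: "v \<in> sign_vectors d" and i: "i < d"
  shows "(\<integral>s. hard_grad x s i \<partial>point_measure S (m v)) =
    A * \<rho> / 2 * ((1 + \<epsilon> * v i) * sgn (x i - r) + (1 - \<epsilon> * v i) * sgn (x i + r))"
proof -
  have "(\<integral>s. hard_grad x s i \<partial>point_measure S (m v)) = (\<Sum>s\<in>S. m v s * hard_grad x s i)"
    by (subst lebesgue_integral_point_measure_finite) (use finite_S m_nonneg v in auto)
  also have "\<dots> = (\<Sum>s\<in>S. A * (sgn (x i - r) * (if s i = 1 then m v s else 0)
      + sgn (x i + r) * (if s i = -1 then m v s else 0)))"
    by (intro sum.cong refl) (use i in \<open>auto simp: hard_grad_def\<close>)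
  also have "\<dots> = A * (sgn (x i - r) * (\<Sum>s\<in>S. if s i = 1 then m v s else 0)
      + sgn (x i + r) * (\<Sum>s\<in>S. if s i = -1 then m v s else 0))"
    by (simp only: sum_distrib_left[symmetric] sum.distrib)
  also have "\<dots> = A * \<rho> / 2 * ((1 + \<epsilon> * v i) * sgn (x i - r) + (1 - \<epsilon> * v i) * sgn (x i + r))"
  proof -
    have "(\<Sum>s\<in>S. if s i = 1 then m v s else 0) = \<rho> * (1 + \<epsilon> * v i) / 2"
      "(\<Sum>s\<in>S. if s i = -1 then m v s else 0) = \<rho> * (1 - \<epsilon> * v i) / 2"
      using m_marginal[OF v i, of 1] m_marginal[OF v i, of "-1"] by simp_all
    then show ?thesis by (simp only:) (simp add: field_simps)
  qed
  finally show ?thesis .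
qed

lemma mean_hard_grad_subdifferential:
  assumes v: "v \<in> sign_vectors d"
  shows "(\<lambda>i. \<integral>s. hard_grad x s i \<partial>point_measure S (m v)) \<in> subdifferential d (hard_fun v) x"
  unfolding subdifferential_def
proof (intro CollectI conjI ballI)
  show "(\<lambda>i. \<integral>s. hard_grad x s i \<partial>point_measure S (m v)) \<in> rvec d"
    by (simp add: rvec_def hard_grad_def)
next
  fix y
  \<comment> \<open>Subgradient inequality of the absolute value; it includes the kink
    \<open>a + c = 0\<close>, where the slope is 0.\<close>
  have sub: "\<bar>b + c\<bar> \<ge> \<bar>a + c\<bar> + sgn (a + c) * (b - a)" for a b c :: real
    by (auto simp: sgn_if)
  have "hard_fun v x + (\<Sum>i<d. (\<integral>s. hard_grad x s i \<partial>point_measure S (m v)) * (y i - x i))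
    = (\<Sum>i<d. A * \<rho> / 2 * ((1 + \<epsilon> * v i) * (\<bar>x i - r\<bar> + sgn (x i - r) * (y i - x i))
        + (1 - \<epsilon> * v i) * (\<bar>x i + r\<bar> + sgn (x i + r) * (y i - x i))))"
    unfolding hard_fun_def sum.distrib[symmetric]
    by (intro sum.cong refl) (simp add: integral_hard_grad[OF v] field_simps)
  also have "\<dots> \<le> hard_fun v y"
    unfolding hard_fun_def
    by (intro sum_mono mult_left_mono add_mono)
       (use sub[of _ "- r"] sub[of _ r] weights[OF v] A \<rho> in auto)
  finally show "hard_fun v y \<ge> hard_fun v x + (\<Sum>i<d. (\<integral>s. hard_grad x s i \<partial>point_measure S (m v)) * (y i - x i))" .
qed

text \<open>The stationary law \<open>D\<close> is the law of one sample and the kernel is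
  constantly \<open>D\<close>, so the total variation distance is 0. The finite sample space is
  discrete, so measurability in the sample is automatic.\<close>

lemma hard_oracle_admissible:
  assumes v: "v \<in> sign_vectors d" and \<tau>: "\<tau> \<ge> 1"
  shows "hard_oracle \<tau> v \<in> admissible d X (hard_fun v) \<tau> G p"
proof -
  define D where "D = point_measure S (m v)"
  have D: "prob_space D" unfolding D_def by (rule prob_space_samples[OF v])
  have [measurable_cong]: "sets D = sets (count_space S)"
    unfolding D_def by (rule sets_point_measure_count_space)
  have sD: "space D = S" by (simp add: D_def space_point_measure)
  have Q: "sample_space (hard_oracle \<tau> v) = D" "law (hard_oracle \<tau> v) = block_law \<tau> D"
    "grad (hard_oracle \<tau> v) = hard_grad"
    by (simp_all add: hard_oracle_def D_def)
  have meas: "(\<lambda>(x, s). hard_grad x s) \<in> restrict_space borel X \<Otimes>\<^sub>M D \<rightarrow>\<^sub>M borel"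
  proof (rule measurable_coordinatewise_then_product)
    fix i
    have [measurable]: "(\<lambda>x :: rvector. x i) \<in> borel_measurable (restrict_space borel X)"
      by (intro measurable_restrict_space1) measurable
    have [measurable]: "(\<lambda>s :: rvector. s i) \<in> borel_measurable D"
      by (simp add: D_def)
    show "(\<lambda>z. (case z of (x, s) \<Rightarrow> hard_grad x s) i) \<in> borel_measurable (restrict_space borel X \<Otimes>\<^sub>M D)"
      unfolding hard_grad_def case_prod_beta by (cases "i < d") (simp_all, measurable)
  qed
  have lp: "lp_norm d p (hard_grad x s) \<le> G" if "s \<in> S" for x s
    by (rule lp_bound[OF that]) (use A in \<open>auto simp: hard_grad_def abs_mult sgn_if\<close>)
  have "is_stoch_oracle d X (hard_oracle \<tau> v)"
    unfolding is_stoch_oracle_def Q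
    using prob_space_block_law[OF D] meas by (auto simp: rvec_def hard_grad_def)
  moreover have "\<forall>t. is_cond_distr (hard_oracle \<tau> v) t (t + \<tau>) (\<lambda>_. D)"
    using block_law_cond_distr[OF D \<tau> Q(1,2)] by blast
  ultimately show ?thesis
    unfolding admissible_def
    by (intro CollectI conjI exI[of _ D] exI[of _ "\<lambda>_ _. D"])
       (use D lp mean_hard_grad_subdifferential[OF v] in \<open>simp_all add: Q sD D_def[symmetric]\<close>)
qed

section \<open>From wrong signs to the minimax error\<close>

text \<open>Zero counts as wrong for both signs, so every point is wrong at \<open>i\<close> for
  \<open>v\<close> or for its flip.\<close>

definition wrong :: "rvector \<Rightarrow> rvector \<Rightarrow> nat \<Rightarrow> real" where
  "wrong v x i = (if x i * v i \<le> 0 then 1 else 0)"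

text \<open>The competitor \<open>y\<close> with entries \<open>r * v i\<close> lies in the ball and
  hence in \<open>X\<close>, so the infimum is at most its value. The objective separates over
  coordinates, and each wrong sign costs at least \<open>A * \<rho> * r * \<epsilon>\<close> more
  than \<open>y\<close>.\<close>

lemma opt_gap_hard_fun_ge:
  assumes v: "v \<in> sign_vectors d"
  shows "ennreal (A * \<rho> * r * \<epsilon> * (\<Sum>i<d. wrong v x i)) \<le> e2ennreal (opt_gap X (hard_fun v) x)"
proof -
  define y :: rvector where "y = (\<lambda>i. if i < d then r * v i else 0)"
  have "y \<in> rvec d" by (simp add: y_def rvec_def)
  moreover have "lp_norm d \<infinity> y \<le> r"
  proof -
    have "\<bar>y i\<bar> \<le> r" if "i < d" for i
      using sign_vectors_cases[OF v that] r that by (auto simp: y_def)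
    then show ?thesis using d by (auto simp: lp_norm_def lessThan_empty_iff intro!: Max.boundedI)
  qed
  ultimately have "y \<in> X" using X by auto
  have fy: "hard_fun v y = (\<Sum>i<d. A * \<rho> * r * (1 - \<epsilon>))"
    unfolding hard_fun_def
  proof (intro sum.cong refl)
    fix i assume "i \<in> {..<d}"
    then have "y i = r * v i" "v i = -1 \<or> v i = 1"
      using sign_vectors_cases[OF v] by (auto simp: y_def)
    then have "(1 + \<epsilon> * v i) * \<bar>y i - r\<bar> + (1 - \<epsilon> * v i) * \<bar>y i + r\<bar> = 2 * (r * (1 - \<epsilon>))"
      using r by (elim disjE) simp_all
    then show "A * \<rho> / 2 * ((1 + \<epsilon> * v i) * \<bar>y i - r\<bar> + (1 - \<epsilon> * v i) * \<bar>y i + r\<bar>) = A * \<rho> * r * (1 - \<epsilon>)"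
      by (simp only:) simp
  qed
  have eq: "A * \<rho> * r * \<epsilon> * w + A * \<rho> * r * (1 - \<epsilon>) = A * \<rho> / 2 * (2 * r * (1 - \<epsilon> + \<epsilon> * w))" for w
    by (simp add: field_simps)
  have "A * \<rho> * r * \<epsilon> * (\<Sum>i<d. wrong v x i) + hard_fun v y = (\<Sum>i<d. A * \<rho> / 2 * (2 * r * (1 - \<epsilon> + \<epsilon> * wrong v x i)))"
    unfolding fy sum_distrib_left sum.distrib[symmetric] by (intro sum.cong refl eq)
  also have "\<dots> \<le> hard_fun v x"
    unfolding hard_fun_def
  proof (intro sum_mono mult_left_mono)
    fix i assume i: "i \<in> {..<d}"
    \<comment> \<open>The case \<open>v i = 1\<close> in units of \<open>A * \<rho> / 2\<close>: the
      minimum \<open>2 * r * (1 - \<epsilon>)\<close> is attained at \<open>a = r\<close>, and on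
      \<open>a \<le> 0\<close> the value is at least \<open>2 * r\<close>. Reflecting
      \<open>a\<close> to \<open>- a\<close> covers \<open>v i = -1\<close>.\<close>
    have key: "2 * r * (1 - \<epsilon> + \<epsilon> * (if a \<le> 0 then 1 else 0)) \<le> (1 + \<epsilon>) * \<bar>a - r\<bar> + (1 - \<epsilon>) * \<bar>a + r\<bar>" for a
    proof (cases "a \<le> 0")
      case True
      have "(1 + \<epsilon>) * (r - a) + (1 - \<epsilon>) * (a + r) \<le> (1 + \<epsilon>) * \<bar>a - r\<bar> + (1 - \<epsilon>) * \<bar>a + r\<bar>"
        by (intro add_mono mult_left_mono) (use \<epsilon> in auto)
      moreover have "(1 + \<epsilon>) * (r - a) + (1 - \<epsilon>) * (a + r) = 2 * r - 2 * (\<epsilon> * a)"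
        by (simp add: algebra_simps)
      moreover have "\<epsilon> * a \<le> 0" using True \<epsilon> by (simp add: mult_nonneg_nonpos)
      ultimately show ?thesis using True by simp
    next
      case False
      have "(1 - \<epsilon>) * (r - a) \<le> (1 - \<epsilon>) * \<bar>a - r\<bar>"
        by (intro mult_left_mono) (use \<epsilon> in auto)
      also have "\<dots> \<le> (1 + \<epsilon>) * \<bar>a - r\<bar>"
        by (intro mult_right_mono) (use \<epsilon> in auto)
      finally have "(1 - \<epsilon>) * (r - a) + (1 - \<epsilon>) * (a + r) \<le> (1 + \<epsilon>) * \<bar>a - r\<bar> + (1 - \<epsilon>) * \<bar>a + r\<bar>"
        by (intro add_mono mult_left_mono) (use \<epsilon> in auto)
      moreover have "(1 - \<epsilon>) * (r - a) + (1 - \<epsilon>) * (a + r) = 2 * r * (1 - \<epsilon>)"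
        by (simp add: algebra_simps)
      ultimately show ?thesis using False by simp
    qed
    consider "v i = 1" | "v i = -1" using sign_vectors_cases[OF v] i by blast
    then show "2 * r * (1 - \<epsilon> + \<epsilon> * wrong v x i)
      \<le> (1 + \<epsilon> * v i) * \<bar>x i - r\<bar> + (1 - \<epsilon> * v i) * \<bar>x i + r\<bar>"
    proof cases
      case 1 then show ?thesis using key[of "x i"] by (simp add: wrong_def)
    next
      case 2
      have "\<bar>- x i - r\<bar> = \<bar>x i + r\<bar>" "\<bar>- x i + r\<bar> = \<bar>x i - r\<bar>" by linarith+
      then show ?thesis using key[of "- x i"] 2 by (simp add: wrong_def)
    qed
  qed (use A \<rho> in simp)
  finally have "A * \<rho> * r * \<epsilon> * (\<Sum>i<d. wrong v x i) \<le> hard_fun v x - hard_fun v y" by simp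
  moreover have "ereal (hard_fun v x - hard_fun v y) \<le> opt_gap X (hard_fun v) x"
  proof -
    have "ereal (hard_fun v x) - ereal (hard_fun v y) \<le> opt_gap X (hard_fun v) x"
      unfolding opt_gap_def by (intro ereal_minus_mono order.refl INF_lower \<open>y \<in> X\<close>)
    then show ?thesis by simp
  qed
  ultimately have "ereal (A * \<rho> * r * \<epsilon> * (\<Sum>i<d. wrong v x i)) \<le> opt_gap X (hard_fun v) x"
    by (meson ereal_less_eq(3) order.trans)
  then show ?thesis
    by (metis e2ennreal_ereal e2ennreal_mono)
qed

text \<open>The expected number of wrong signs is averaged over all \<open>v\<close>. Pairing
  \<open>v\<close> with its flip at \<open>i\<close> shows that the average error probability at
  each coordinate is at least 1/6, since \<open>small\<close> keeps the two laws of \<open>n\<close>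
  samples at affinity at least 3/4.\<close>

lemma minimax_error_ge:
  assumes \<tau>: "\<tau> \<ge> 1" and T: "T \<ge> 1" and n: "n = (T - 1) div \<tau> + 1" and small: "real n * (\<rho> * \<epsilon>^2) \<le> 1 / 4"
  shows "ennreal (real d * (A * \<rho> * r * \<epsilon>) / 6) \<le> minimax_error (convex_lipschitz d X G q) d X \<tau> G p T"
  unfolding minimax_error_def
proof (rule INF_greatest)
  fix M assume M: "M \<in> strategies X"
  define V where "V = sign_vectors d"
  define H where "H = PiE {..<n} (\<lambda>_. S)"
  define P where "P v h = (\<Prod>j<n. m v (h j))" for v and h :: "nat \<Rightarrow> rvector"
  define b where "b = A * \<rho> * r * \<epsilon>"
  have b: "b \<ge> 0" using A \<rho> r \<epsilon> by (simp add: b_def)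
  \<comment> \<open>All hard oracles share \<open>hard_grad\<close>, so the sign vector in
    \<open>Q0\<close> can be an arbitrary value, and the estimate \<open>x h\<close> does not depend
    on \<open>v\<close>.\<close>
  define Q0 :: "rvector stoch_oracle" where "Q0 = hard_oracle \<tau> undefined"
  define x where "x h = estimate M (answers M Q0 (\<lambda>t. h ((t - 1) div \<tau>)) T)" for h :: "nat \<Rightarrow> rvector"
  define L where "L v = (\<Sum>h\<in>H. P v h * (b * (\<Sum>i<d. wrong v (x h) i)))" for v
  have P0: "0 \<le> P v h" if "v \<in> V" "h \<in> H" for v h
    unfolding P_def by (rule prod_nonneg) (use that in \<open>auto simp: V_def H_def PiE_iff intro!: m_nonneg\<close>)
  have P1: "(\<Sum>h\<in>H. P v h) = 1" if "v \<in> V" for v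
    unfolding P_def H_def
    by (subst prod_sum_PiE[symmetric]) (use that finite_S in \<open>auto simp: V_def m_sum\<close>)
  have w0: "0 \<le> wrong v y i" for v y i by (simp add: wrong_def)
  have lower: "ennreal (L v) \<le> expected_error M (hard_fun v) X (hard_oracle \<tau> v) T" if v: "v \<in> V" for v
  proof -
    define \<phi> where "\<phi> \<omega> = e2ennreal (opt_gap X (hard_fun v) (estimate M (answers M (hard_oracle \<tau> v) \<omega> T)))" for \<omega>
    have ans: "answers M (hard_oracle \<tau> v) \<omega> T = answers M Q0 \<omega> T" for \<omega>
      by (rule answers_cong) (auto simp: Q0_def hard_oracle_def)
    have "ennreal (L v) = (\<Sum>h\<in>H. ennreal (P v h) * ennreal (b * (\<Sum>i<d. wrong v (x h) i)))"
      unfolding L_def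
      by (subst sum_ennreal[symmetric])
         (use P0[OF v] b w0 in \<open>auto intro!: mult_nonneg_nonneg sum_nonneg sum.cong simp: ennreal_mult'\<close>)
    also have "\<dots> \<le> (\<Sum>h\<in>H. ennreal (P v h) * \<phi> (\<lambda>t. h ((t - 1) div \<tau>)))"
      unfolding \<phi>_def ans x_def b_def
      by (intro sum_mono mult_left_mono opt_gap_hard_fun_ge) (use v in \<open>auto simp: V_def\<close>)
    also have "\<dots> \<le> (\<integral>\<^sup>+\<omega>. \<phi> \<omega> \<partial>block_law \<tau> (point_measure S (m v)))"
      unfolding P_def H_def
    proof (rule nn_integral_block_law_ge[OF finite_S _ _ \<tau> T n])
      fix \<omega> \<omega>' :: "nat \<Rightarrow> rvector" assume "\<And>t. t \<in> {1..T} \<Longrightarrow> \<omega> t = \<omega>' t"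
      then show "\<phi> \<omega> = \<phi> \<omega>'" unfolding \<phi>_def using answers_cong[of T \<omega> \<omega>'] by metis
    qed (use v m_nonneg m_sum in \<open>auto simp: V_def\<close>)
    also have "\<dots> = expected_error M (hard_fun v) X (hard_oracle \<tau> v) T"
      unfolding expected_error_def \<phi>_def by (simp add: hard_oracle_def)
    finally show ?thesis .
  qed
  have pair: "1 / 3 \<le> (\<Sum>h\<in>H. P v h * wrong v (x h) i) + (\<Sum>h\<in>H. P (v(i := - v i)) h * wrong (v(i := - v i)) (x h) i)"
    if v: "v \<in> V" and i: "i < d" for v i
  proof -
    let ?v = "v(i := - v i)"
    have v': "?v \<in> V" using bij_betwE[OF bij_flip_sign_vectors[OF i]] v unfolding V_def by blast
    let ?a = "\<Sum>s\<in>S. sqrt (m v s * m ?v s)"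
    have a0: "1 - \<rho> * \<epsilon>^2 \<le> ?a" using m_affinity v i unfolding V_def by blast
    \<comment> \<open>The affinity of \<open>n\<close> independent samples is the
      \<open>n\<close>-th power of that of one sample; Bernoulli's inequality bounds it from below
      by \<open>1 - n * \<rho> * \<epsilon>^2\<close>.\<close>
    have "3 / 4 \<le> 1 + real n * (- (\<rho> * \<epsilon>^2))" using small by simp
    also have "\<dots> \<le> (1 + (- (\<rho> * \<epsilon>^2))) ^ n"
    proof (rule Bernoulli_inequality)
      have "1 * (\<rho> * \<epsilon>^2) \<le> real n * (\<rho> * \<epsilon>^2)" using \<rho> n by (intro mult_right_mono) auto
      then show "- 1 \<le> - (\<rho> * \<epsilon>^2)" using small by simp
    qed
    also have "\<dots> \<le> ?a ^ n"
    proof (rule power_mono)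
      have "1 * (\<rho> * \<epsilon>^2) \<le> real n * (\<rho> * \<epsilon>^2)" using \<rho> n by (intro mult_right_mono) auto
      then show "0 \<le> 1 + (- (\<rho> * \<epsilon>^2))" using small by simp
    qed (use a0 in simp)
    also have "\<dots> = (\<Sum>h\<in>H. sqrt (P v h * P ?v h))"
      unfolding H_def P_def prod.distrib[symmetric] sqrt_prod
      by (subst prod_sum_PiE[symmetric]) (use finite_S in auto)
    finally have "1 / 3 \<le> (\<Sum>h\<in>H. min (P v h) (P ?v h))"
      by (intro sum_min_ge_of_affinity P0 P1 v v')
    \<comment> \<open>For each \<open>h\<close> at least one of the two indicators is 1, so the
      summand is at least the smaller mass.\<close>
    also have "\<dots> \<le> (\<Sum>h\<in>H. P v h * wrong v (x h) i + P ?v h * wrong ?v (x h) i)"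
      by (intro sum_mono) (use P0[OF v] P0[OF v'] in \<open>auto simp: wrong_def min_def\<close>)
    finally show ?thesis by (simp add: sum.distrib)
  qed
  have flip: "(\<Sum>v\<in>V. \<Sum>h\<in>H. P v h * wrong v (x h) i) \<ge> card V / 6" if i: "i < d" for i
  proof -
    define g where "g v = (\<Sum>h\<in>H. P v h * wrong v (x h) i)" for v
    \<comment> \<open>Reindexing by the flip counts every pair twice; with 1/3 per pair this gives
      1/6 per sign vector.\<close>
    have "(\<Sum>v\<in>V. g v) = (\<Sum>v\<in>V. g (v(i := - v i)))"
      unfolding V_def by (rule sum.reindex_bij_betw[OF bij_flip_sign_vectors[OF i], symmetric])
    then have "2 * (\<Sum>v\<in>V. g v) = (\<Sum>v\<in>V. g v + g (v(i := - v i)))"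
      by (simp add: sum.distrib)
    also have "\<dots> \<ge> (\<Sum>v\<in>V. 1 / 3)"
      unfolding g_def by (intro sum_mono pair i)
    finally show ?thesis by (simp add: g_def)
  qed
  have "\<exists>v\<in>V. real d * b / 6 \<le> L v"
  proof (rule ccontr)
    assume "\<not> ?thesis"
    then have "(\<Sum>v\<in>V. L v) < (\<Sum>v\<in>V. real d * b / 6)"
    proof (intro sum_strict_mono)
      show "V \<noteq> {}" by (auto simp: V_def sign_vectors_def PiE_eq_empty_iff)
    qed (auto simp: V_def)
    also have "\<dots> = (\<Sum>i<d. b * (card V / 6))" by simp
    also have "\<dots> \<le> (\<Sum>i<d. b * (\<Sum>v\<in>V. \<Sum>h\<in>H. P v h * wrong v (x h) i))"
      by (intro sum_mono mult_left_mono flip b) auto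
    also have "\<dots> = (\<Sum>i<d. \<Sum>v\<in>V. \<Sum>h\<in>H. P v h * (b * wrong v (x h) i))"
      by (simp add: sum_distrib_left mult.left_commute)
    also have "\<dots> = (\<Sum>v\<in>V. \<Sum>i<d. \<Sum>h\<in>H. P v h * (b * wrong v (x h) i))"
      by (rule sum.swap)
    also have "\<dots> = (\<Sum>v\<in>V. \<Sum>h\<in>H. \<Sum>i<d. P v h * (b * wrong v (x h) i))"
      by (intro sum.cong refl sum.swap)
    also have "\<dots> = (\<Sum>v\<in>V. L v)"
      by (simp add: L_def sum_distrib_left)
    finally show False by simp
  qed
  then obtain v where v: "v \<in> V" "real d * b / 6 \<le> L v" by blast
  have "ennreal (real d * (A * \<rho> * r * \<epsilon>) / 6) \<le> ennreal (L v)"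
    using v(2) unfolding b_def by (rule ennreal_leI)
  also have "\<dots> \<le> expected_error M (hard_fun v) X (hard_oracle \<tau> v) T"
    by (rule lower[OF v(1)])
  also have "\<dots> \<le> (SUP Q\<in>(admissible d X (hard_fun v) \<tau> G p :: rvector stoch_oracle set). expected_error M (hard_fun v) X Q T)"
    by (rule SUP_upper) (use hard_oracle_admissible \<tau> v(1) in \<open>auto simp: V_def\<close>)
  also have "\<dots> \<le> (SUP f\<in>convex_lipschitz d X G q. SUP Q\<in>(admissible d X f \<tau> G p :: rvector stoch_oracle set). expected_error M f X Q T)"
    by (rule SUP_upper) (use hard_fun_convex_lipschitz v(1) in \<open>auto simp: V_def\<close>)
  finally show "ennreal (real d * (A * \<rho> * r * \<epsilon>) / 6) \<le> \<dots>" .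
qed

end

section \<open>Norms and the two families of oracles\<close>

lemma ennreal_ge_1_cases:
  fixes p :: ennreal
  assumes "p \<ge> 1"
  obtains "p = \<infinity>" "enn2real (1 / p) = 0"
  | P where "p = ennreal P" "P \<ge> 1" "enn2real p = P" "p \<noteq> \<infinity>" "enn2real (1 / p) = 1 / P"
proof (cases p)
  case (real P)
  then have "P \<ge> 1" using assms by simp
  moreover have "1 / p = ennreal (1 / P)"
    using real \<open>P \<ge> 1\<close> by (metis divide_ennreal ennreal_1 less_le_trans zero_le_one zero_less_one)
  ultimately show ?thesis using real that(2)[of P] by simp
next
  case top
  then show ?thesis using that(1) by simp
qed

lemma conjugate_exponent:
  fixes p q :: ennreal
  assumes "1 / p + 1 / q = 1"
  shows "enn2real (1 / p) + enn2real (1 / q) = 1" "q \<ge> 1"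
proof -
  have "1 / p \<le> 1 / p + 1 / q" "1 / q \<le> 1 / p + 1 / q"
    by (simp_all add: add_increasing add_increasing2)
  then have le: "1 / p \<le> 1" "1 / q \<le> 1" unfolding assms by simp_all
  then have "1 / p < \<top>" "1 / q < \<top>"
    using ennreal_one_less_top le_less_trans by blast+
  then show "enn2real (1 / p) + enn2real (1 / q) = 1"
    using enn2real_plus[of "1 / p" "1 / q"] assms by simp
  show "q \<ge> 1"
  proof (cases q)
    case (real Q)
    \<comment> \<open>In \<open>ennreal\<close> the quotient \<open>1 / 0\<close> is infinite, which
      \<open>1 / q \<le> 1\<close> excludes.\<close>
    have "Q \<noteq> 0" using le(2) real by (auto simp: top_unique)
    then have "ennreal (1 / Q) = 1 / q"
      using real by (metis divide_ennreal ennreal_1 less_eq_real_def zero_le_one)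
    then have "1 / Q \<le> 1" using le(2) by (metis ennreal_le_1)
    then show ?thesis using \<open>Q \<noteq> 0\<close> real by (simp add: field_simps)
  qed simp
qed

lemma lp_norm_le_uniform:
  assumes "d \<ge> 1" "p \<ge> 1" "A \<ge> 0" and g: "\<And>i. i < d \<Longrightarrow> \<bar>g i\<bar> \<le> A"
  shows "lp_norm d p g \<le> A * real d powr enn2real (1 / p)"
  using \<open>p \<ge> 1\<close>
proof (cases rule: ennreal_ge_1_cases)
  case 1
  then show ?thesis using assms by (auto simp: lp_norm_def lessThan_empty_iff intro!: Max.boundedI)
next
  case (2 P)
  have "(\<Sum>i<d. \<bar>g i\<bar> powr P) \<le> (\<Sum>i<d. A powr P)"
    by (intro sum_mono powr_mono2) (use 2 g in auto)
  then have "lp_norm d p g \<le> (real d * A powr P) powr (1 / P)"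
    using 2 unfolding lp_norm_def by (auto intro!: powr_mono2 sum_nonneg)
  also have "\<dots> = A * real d powr (1 / P)"
    using 2 \<open>A \<ge> 0\<close> by (simp add: powr_mult powr_powr)
  finally show ?thesis using 2 by simp
qed

lemma lp_norm_le_single:
  assumes "k < d" "p \<ge> 1" and g: "\<And>i. i < d \<Longrightarrow> i \<noteq> k \<Longrightarrow> g i = 0" "\<bar>g k\<bar> \<le> A"
  shows "lp_norm d p g \<le> A"
  using \<open>p \<ge> 1\<close>
proof (cases rule: ennreal_ge_1_cases)
  case 1
  have "\<bar>g i\<bar> \<le> A" if "i < d" for i
    using g that by (cases "i = k") auto
  then show ?thesis using 1 assms(1) by (auto simp: lp_norm_def lessThan_empty_iff intro!: Max.boundedI)
next
  case (2 P)
  have "(\<Sum>i<d. \<bar>g i\<bar> powr P) = (\<Sum>i\<in>{k}. \<bar>g i\<bar> powr P)"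
    by (rule sum.mono_neutral_right) (use assms(1) g in auto)
  then have "lp_norm d p g = \<bar>g k\<bar>"
    using 2 unfolding lp_norm_def by (simp add: powr_powr)
  then show ?thesis using g by simp
qed

text \<open>Hoelder's inequality against the all-ones vector. For finite \<open>q\<close> it follows
  from Young's inequality after rescaling by the norm, so norm zero is a separate case.\<close>

lemma sum_abs_le_lp_norm:
  assumes "d \<ge> 1" "q \<ge> 1"
  shows "(\<Sum>i<d. \<bar>z i\<bar>) \<le> real d powr (1 - enn2real (1 / q)) * lp_norm d q z"
  using \<open>q \<ge> 1\<close>
proof (cases rule: ennreal_ge_1_cases)
  case 1
  have "(\<Sum>i<d. \<bar>z i\<bar>) \<le> (\<Sum>i<d. lp_norm d q z)"
    by (rule sum_mono) (auto simp: lp_norm_def 1)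
  then show ?thesis using 1 \<open>d \<ge> 1\<close> by simp
next
  case (2 Q)
  define N where "N = lp_norm d q z"
  have N: "N = (\<Sum>i<d. \<bar>z i\<bar> powr Q) powr (1 / Q)"
    using 2 by (simp add: N_def lp_norm_def)
  have s0: "0 \<le> (\<Sum>i<d. \<bar>z i\<bar> powr Q)" by (simp add: sum_nonneg)
  have NQ: "N powr Q = (\<Sum>i<d. \<bar>z i\<bar> powr Q)"
    unfolding N using 2 s0 by (simp add: powr_powr)
  show ?thesis
  proof (cases "N = 0")
    case True
    then have "(\<Sum>i<d. \<bar>z i\<bar> powr Q) = 0" using NQ by simp
    then have "\<forall>i<d. \<bar>z i\<bar> powr Q = 0"
      by (subst (asm) sum_nonneg_eq_0_iff) auto
    then have "(\<Sum>i<d. \<bar>z i\<bar>) = 0" by simp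
    then show ?thesis using True by (simp add: N_def)
  next
    case False
    then have Npos: "N > 0" unfolding N by simp
    define c where "c = N * real d powr (- (1 / Q))"
    have c: "c > 0" using Npos \<open>d \<ge> 1\<close> by (simp add: c_def)
    have cQ: "c powr Q = N powr Q / real d"
      unfolding c_def using Npos 2 \<open>d \<ge> 1\<close> by (simp add: powr_mult powr_divide powr_powr powr_minus_divide)
    \<comment> \<open>Young's inequality for \<open>t\<close> and \<open>1\<close>; the scale \<open>c\<close> makes the mean of \<open>(\<bar>z i\<bar> / c) powr Q\<close> equal to 1\<close>
    have young: "t \<le> t powr Q / Q + (1 - 1 / Q)" if "t \<ge> 0" for t
    proof (cases "t = 0")
      case True
      then show ?thesis using 2 by simp
    next
      case False
      then show ?thesis
        using Youngs_inequality_0[of "1 / Q" "1 - 1 / Q" "t powr Q" 1] 2 that by (simp add: powr_powr)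
    qed
    have "(\<Sum>i<d. \<bar>z i\<bar> / c) \<le> (\<Sum>i<d. (\<bar>z i\<bar> / c) powr Q / Q + (1 - 1 / Q))"
      by (intro sum_mono young) (use c in auto)
    also have "\<dots> = (\<Sum>i<d. \<bar>z i\<bar> powr Q) / c powr Q / Q + real d * (1 - 1 / Q)"
      using c by (simp add: sum.distrib powr_divide sum_divide_distrib)
    also have "\<dots> = real d"
      unfolding NQ[symmetric] cQ using Npos 2 \<open>d \<ge> 1\<close> by (simp add: field_simps)
    finally have "(\<Sum>i<d. \<bar>z i\<bar>) \<le> real d * c"
      using c by (simp add: pos_divide_le_eq flip: sum_divide_distrib)
    also have "real d * c = real d powr (1 - 1 / Q) * N"
      unfolding c_def using \<open>d \<ge> 1\<close> by (simp add: powr_diff powr_minus_divide)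
    finally show ?thesis using 2 by (simp add: N_def)
  qed
qed

lemma one_minus_le_sqrt:
  fixes x :: real
  assumes "0 \<le> x" "x \<le> 1"
  shows "1 - x \<le> sqrt (1 - x)"
  by (rule real_le_rsqrt) (use assms in \<open>simp add: power2_eq_square mult_left_le\<close>)

lemma one_plus_signs_nonneg:
  fixes \<epsilon> a b :: real
  assumes "0 \<le> \<epsilon>" "\<epsilon> \<le> 1" "a \<in> {-1, 1}" "b \<in> {-1, 1}"
  shows "0 \<le> 1 + \<epsilon> * a * b"
  using assms by auto

section \<open>First family: independent coordinates\<close>

definition cube_mass :: "nat \<Rightarrow> real \<Rightarrow> rvector \<Rightarrow> rvector \<Rightarrow> real" where
  "cube_mass d \<epsilon> v s = (\<Prod>k<d. (1 + \<epsilon> * s k * v k) / 2)"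

lemma sum_sign_vectors_prod:
  fixes f :: "nat \<Rightarrow> real \<Rightarrow> real"
  shows "(\<Sum>s\<in>sign_vectors d. \<Prod>k<d. f k (s k)) = (\<Prod>k<d. f k (-1) + f k 1)"
  unfolding sign_vectors_def by (subst prod_sum_PiE[symmetric]) auto

text \<open>A vector with all entries \<open>A\<close> has p-norm A d^(1/p), and the choice of
  \<open>A\<close> makes this equal to \<open>G\<close>. As 1 - 1/q = 1/p, the same power of
  \<open>d\<close> yields \<open>lq_bound\<close>.\<close>

lemma hard_instance_cube:
  assumes d: "d \<ge> 1" and r: "r > 0" and X: "X \<subseteq> rvec d" "{x \<in> rvec d. lp_norm d \<infinity> x \<le> r} \<subseteq> X"
    and \<epsilon>: "0 \<le> \<epsilon>" "\<epsilon> \<le> 1" and G: "G > 0" and p: "p \<ge> 1" and pq: "1 / p + 1 / q = 1"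
  shows "hard_instance d X (sign_vectors d) (cube_mass d \<epsilon>) 1 \<epsilon> (G * real d powr (- enn2real (1 / p))) r G p q"
proof
  let ?A = "G * real d powr (- enn2real (1 / p))"
  show "0 \<le> cube_mass d \<epsilon> v s" if "v \<in> sign_vectors d" "s \<in> sign_vectors d" for v s
    unfolding cube_mass_def
  proof (rule prod_nonneg)
    fix k assume "k \<in> {..<d}"
    then have "0 \<le> 1 + \<epsilon> * s k * v k"
      using sign_vectors_cases[OF that(1), of k] sign_vectors_cases[OF that(2), of k]
      by (intro one_plus_signs_nonneg \<epsilon>) auto
    then show "0 \<le> (1 + \<epsilon> * s k * v k) / 2" by simp
  qed
  show "(\<Sum>s\<in>sign_vectors d. cube_mass d \<epsilon> v s) = 1" for v
    unfolding cube_mass_def by (subst sum_sign_vectors_prod) (simp add: field_simps)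
  show "(\<Sum>s\<in>sign_vectors d. if s i = \<sigma> then cube_mass d \<epsilon> v s else 0) = 1 * (1 + \<epsilon> * \<sigma> * v i) / 2"
    if i: "i < d" and \<sigma>: "\<sigma> \<in> {-1, 1}" for v i \<sigma>
  proof -
    \<comment> \<open>The event \<open>s i = \<sigma>\<close> is encoded as a zero factor at
      \<open>k = i\<close>, so that the sum still factorizes; the other factors sum to 1.\<close>
    have "(\<Sum>s\<in>sign_vectors d. if s i = \<sigma> then cube_mass d \<epsilon> v s else 0)
      = (\<Sum>s\<in>sign_vectors d. \<Prod>k<d. if k = i \<and> s k \<noteq> \<sigma> then 0 else (1 + \<epsilon> * s k * v k) / 2)"
    proof (intro sum.cong refl)
      fix s
      show "(if s i = \<sigma> then cube_mass d \<epsilon> v s else 0) = (\<Prod>k<d. if k = i \<and> s k \<noteq> \<sigma> then 0 else (1 + \<epsilon> * s k * v k) / 2)"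
      proof (cases "s i = \<sigma>")
        case True
        then show ?thesis unfolding cube_mass_def by (auto intro!: prod.cong)
      next
        case False
        then show ?thesis using i by (auto intro!: prod_zero[symmetric])
      qed
    qed
    also have "\<dots> = (\<Prod>k<d. (if k = i \<and> -1 \<noteq> \<sigma> then 0 else (1 + \<epsilon> * (-1) * v k) / 2)
        + (if k = i \<and> 1 \<noteq> \<sigma> then 0 else (1 + \<epsilon> * 1 * v k) / 2))"
      by (rule sum_sign_vectors_prod)
    also have "\<dots> = (\<Prod>k<d. if k = i then (1 + \<epsilon> * \<sigma> * v i) / 2 else 1)"
      by (intro prod.cong refl) (use \<sigma> in \<open>auto simp: field_simps\<close>)
    also have "\<dots> = (1 + \<epsilon> * \<sigma> * v i) / 2" using i by simp
    finally show ?thesis by simp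
  qed
  show "(\<Sum>s\<in>sign_vectors d. sqrt (cube_mass d \<epsilon> v s * cube_mass d \<epsilon> (v(i := - v i)) s)) \<ge> 1 - 1 * \<epsilon>^2"
    if v: "v \<in> sign_vectors d" and i: "i < d" for v i
  proof -
    let ?f = "\<lambda>k \<sigma>. sqrt ((1 + \<epsilon> * \<sigma> * v k) / 2 * ((1 + \<epsilon> * \<sigma> * (v(i := - v i)) k) / 2))"
    have "(\<Sum>s\<in>sign_vectors d. sqrt (cube_mass d \<epsilon> v s * cube_mass d \<epsilon> (v(i := - v i)) s))
      = (\<Sum>s\<in>sign_vectors d. \<Prod>k<d. ?f k (s k))"
      unfolding cube_mass_def prod.distrib[symmetric] sqrt_prod ..
    also have "\<dots> = (\<Prod>k<d. ?f k (-1) + ?f k 1)"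
      by (rule sum_sign_vectors_prod)
    \<comment> \<open>For \<open>k \<noteq> i\<close> the factors of the two masses agree and sum to
      1. At \<open>k = i\<close> each of the two terms is
      \<open>sqrt (1 - \<epsilon>^2) / 2\<close>.\<close>
    also have "\<dots> = (\<Prod>k<d. if k = i then sqrt (1 - \<epsilon>^2) else 1)"
    proof (intro prod.cong refl)
      fix k assume k: "k \<in> {..<d}"
      show "?f k (-1) + ?f k 1 = (if k = i then sqrt (1 - \<epsilon>^2) else 1)"
      proof (cases "k = i")
        case True
        have "(1 + \<epsilon> * \<sigma> * v i) / 2 * ((1 + \<epsilon> * \<sigma> * (- v i)) / 2) = (1 - \<epsilon>^2) / 2^2"
          if "\<sigma> = 1 \<or> \<sigma> = -1" for \<sigma> :: real
          using sign_vectors_cases[OF v i] that by (auto simp: power2_eq_square field_simps)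
        then have fi: "?f i \<sigma> = sqrt (1 - \<epsilon>^2) / 2" if "\<sigma> = 1 \<or> \<sigma> = -1" for \<sigma> :: real
          using that by (simp add: real_sqrt_divide)
        have "?f k (-1) + ?f k 1 = sqrt (1 - \<epsilon>^2) / 2 + sqrt (1 - \<epsilon>^2) / 2"
          unfolding True by (intro arg_cong2[where f = "(+)"] fi) simp_all
        also have "\<dots> = (if k = i then sqrt (1 - \<epsilon>^2) else 1)" using True by simp
        finally show ?thesis .
      next
        case False
        have f: "?f k \<sigma> = (1 + \<epsilon> * \<sigma> * v k) / 2" if "0 \<le> 1 + \<epsilon> * \<sigma> * v k" for \<sigma>
        proof -
          have "?f k \<sigma> = \<bar>(1 + \<epsilon> * \<sigma> * v k) / 2\<bar>"
            using False by (simp only: fun_upd_other real_sqrt_abs2 not_False_eq_True)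
          then show ?thesis using that by simp
        qed
        have "1 + \<epsilon> * v k \<ge> 0" "1 - \<epsilon> * v k \<ge> 0"
          using sign_vectors_cases[OF v, of k] k \<epsilon> by auto
        then have "?f k (-1) = (1 - \<epsilon> * v k) / 2" "?f k 1 = (1 + \<epsilon> * v k) / 2"
          using f[of "-1"] f[of 1] by simp_all
        then have "?f k (-1) + ?f k 1 = 1"
          by (simp only: add_divide_distrib[symmetric]) simp
        then show ?thesis using False by simp
      qed
    qed
    also have "\<dots> = sqrt (1 - \<epsilon>^2)" using i by simp
    also have "\<dots> \<ge> 1 - \<epsilon>^2"
      by (rule one_minus_le_sqrt) (use \<epsilon> in \<open>auto simp: power_le_one\<close>)
    finally show ?thesis by simp
  qed
  show "lp_norm d p g \<le> G" if "s \<in> sign_vectors d"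
    and g: "\<And>i. i < d \<Longrightarrow> \<bar>g i\<bar> \<le> (if s i = -1 \<or> s i = 1 then ?A else 0)" for s g
  proof -
    have "\<bar>g i\<bar> \<le> ?A" if "i < d" for i
      using g[OF that] G by (auto split: if_splits intro: order.trans)
    then have "lp_norm d p g \<le> ?A * real d powr enn2real (1 / p)"
      by (intro lp_norm_le_uniform d p) (use G in auto)
    also have "\<dots> = G" using d by (simp add: powr_minus)
    finally show ?thesis .
  qed
  show "?A * 1 * (\<Sum>i<d. \<bar>z i\<bar>) \<le> G * lp_norm d q z" for z
  proof -
    have "?A * 1 * (\<Sum>i<d. \<bar>z i\<bar>) \<le> ?A * (real d powr (1 - enn2real (1 / q)) * lp_norm d q z)"
      using sum_abs_le_lp_norm[OF d conjugate_exponent(2)[OF pq], of z] G by (simp add: mult_left_mono)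
    also have "1 - enn2real (1 / q) = enn2real (1 / p)"
      using conjugate_exponent(1)[OF pq] by simp
    also have "?A * (real d powr enn2real (1 / p) * lp_norm d q z) = G * lp_norm d q z"
      using d by (simp add: powr_minus)
    finally show ?thesis .
  qed
qed (use d r X \<epsilon> G in auto)

section \<open>Second family: a single random axis\<close>

definition axis_vec :: "nat \<Rightarrow> real \<Rightarrow> rvector" where
  "axis_vec k \<sigma> = (\<lambda>i. if i = k then \<sigma> else 0)"

definition signed_axes :: "nat \<Rightarrow> rvector set" where
  "signed_axes d = (\<lambda>(k, \<sigma>). axis_vec k \<sigma>) ` ({..<d} \<times> {-1, 1})"

lemma sum_signed_axes:
  fixes f :: "rvector \<Rightarrow> real"
  shows "(\<Sum>s\<in>signed_axes d. f s) = (\<Sum>k<d. f (axis_vec k (-1)) + f (axis_vec k 1))"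
proof -
  have "inj_on (\<lambda>(k, \<sigma>). axis_vec k \<sigma>) ({..<d} \<times> {-1, 1})"
  proof (rule inj_onI, clarify)
    fix k l and \<sigma> \<sigma>' :: real
    assume *: "axis_vec k \<sigma> = axis_vec l \<sigma>'" "\<sigma> \<in> {-1, 1}"
    have "axis_vec k \<sigma> k = axis_vec l \<sigma>' k" using *(1) by simp
    then show "k = l \<and> \<sigma> = \<sigma>'" using *(2) by (auto simp: axis_vec_def split: if_splits)
  qed
  then have "(\<Sum>s\<in>signed_axes d. f s) = (\<Sum>(k, \<sigma>)\<in>{..<d} \<times> {-1, 1}. f (axis_vec k \<sigma>))"
    unfolding signed_axes_def by (subst sum.reindex) (auto simp: case_prod_beta)
  also have "\<dots> = (\<Sum>k<d. \<Sum>\<sigma>\<in>{-1, 1}. f (axis_vec k \<sigma>))"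
    by (rule sum.cartesian_product[symmetric])
  finally show ?thesis by simp
qed

text \<open>For \<open>k < d\<close> the inner product at \<open>axis_vec k \<sigma>\<close> equals
  \<open>\<sigma> * v k\<close>. This gives a uniform axis with a biased sign, without recovering
  \<open>k\<close> from the sample.\<close>

definition axes_mass :: "nat \<Rightarrow> real \<Rightarrow> rvector \<Rightarrow> rvector \<Rightarrow> real" where
  "axes_mass d \<epsilon> v s = (1 + \<epsilon> * (\<Sum>k<d. s k * v k)) / (2 * real d)"

lemma axes_mass_axis_vec:
  assumes "k < d"
  shows "axes_mass d \<epsilon> v (axis_vec k \<sigma>) = (1 + \<epsilon> * \<sigma> * v k) / (2 * real d)"
proof -
  have "(\<Sum>i<d. axis_vec k \<sigma> i * v i) = (\<Sum>i<d. if i = k then \<sigma> * v k else 0)"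
    by (intro sum.cong) (auto simp: axis_vec_def)
  then show ?thesis using assms by (simp add: axes_mass_def mult.assoc)
qed

text \<open>A vector supported on one coordinate has the same norm for every \<open>p\<close>, so
  \<open>A = G\<close> is allowed. A flip at \<open>i\<close> affects only the samples on axis
  \<open>i\<close>, of total mass \<open>1 / d\<close>, so the loss of affinity shrinks by that
  factor.\<close>

lemma hard_instance_axes:
  assumes d: "d \<ge> 1" and r: "r > 0" and X: "X \<subseteq> rvec d" "{x \<in> rvec d. lp_norm d \<infinity> x \<le> r} \<subseteq> X"
    and \<epsilon>: "0 \<le> \<epsilon>" "\<epsilon> \<le> 1" and G: "G > 0" and p: "p \<ge> 1" and pq: "1 / p + 1 / q = 1"
  shows "hard_instance d X (signed_axes d) (axes_mass d \<epsilon>) (1 / real d) \<epsilon> G r G p q"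
proof
  show "finite (signed_axes d)" by (simp add: signed_axes_def)
  show "0 \<le> axes_mass d \<epsilon> v s" if v: "v \<in> sign_vectors d" and s: "s \<in> signed_axes d" for v s
  proof -
    from s obtain k \<sigma> where k: "k < d" "\<sigma> \<in> {-1, 1}" "s = axis_vec k \<sigma>"
      by (auto simp: signed_axes_def)
    have "0 \<le> 1 + \<epsilon> * \<sigma> * v k"
      using sign_vectors_cases[OF v k(1)] k(2) by (intro one_plus_signs_nonneg \<epsilon>) auto
    then show ?thesis using k by (simp add: axes_mass_axis_vec)
  qed
  show "(\<Sum>s\<in>signed_axes d. axes_mass d \<epsilon> v s) = 1" for v
  proof -
    have "(\<Sum>s\<in>signed_axes d. axes_mass d \<epsilon> v s) = (\<Sum>k<d. 1 / real d)"
      unfolding sum_signed_axes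
      by (intro sum.cong refl) (simp add: axes_mass_axis_vec flip: add_divide_distrib)
    then show ?thesis using d by simp
  qed
  show "(\<Sum>s\<in>signed_axes d. if s i = \<sigma> then axes_mass d \<epsilon> v s else 0) = 1 / real d * (1 + \<epsilon> * \<sigma> * v i) / 2"
    if i: "i < d" and \<sigma>: "\<sigma> \<in> {-1, 1}" for v i \<sigma>
  proof -
    have "(\<Sum>s\<in>signed_axes d. if s i = \<sigma> then axes_mass d \<epsilon> v s else 0)
      = (\<Sum>k<d. if k = i then (1 + \<epsilon> * \<sigma> * v i) / (2 * real d) else 0)"
      unfolding sum_signed_axes
    proof (intro sum.cong refl)
      fix k assume "k \<in> {..<d}"
      then show "(if axis_vec k (-1) i = \<sigma> then axes_mass d \<epsilon> v (axis_vec k (-1)) else 0)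
          + (if axis_vec k 1 i = \<sigma> then axes_mass d \<epsilon> v (axis_vec k 1) else 0)
        = (if k = i then (1 + \<epsilon> * \<sigma> * v i) / (2 * real d) else 0)"
        using \<sigma> by (auto simp: axes_mass_axis_vec) (auto simp: axis_vec_def)
    qed
    then show ?thesis using i by (simp add: mult.commute)
  qed
  show "(\<Sum>s\<in>signed_axes d. sqrt (axes_mass d \<epsilon> v s * axes_mass d \<epsilon> (v(i := - v i)) s)) \<ge> 1 - 1 / real d * \<epsilon>^2"
    if v: "v \<in> sign_vectors d" and i: "i < d" for v i
  proof -
    let ?f = "\<lambda>k \<sigma>. sqrt (axes_mass d \<epsilon> v (axis_vec k \<sigma>) * axes_mass d \<epsilon> (v(i := - v i)) (axis_vec k \<sigma>))"
    have "(\<Sum>k<d. 1 / real d - (if k = i then \<epsilon>^2 / real d else 0)) \<le> (\<Sum>k<d. ?f k (-1) + ?f k 1)"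
    proof (rule sum_mono)
      fix k assume "k \<in> {..<d}"
      then have k: "k < d" by simp
      show "1 / real d - (if k = i then \<epsilon>^2 / real d else 0) \<le> ?f k (-1) + ?f k 1"
      proof (cases "k = i")
        case True
        have "axes_mass d \<epsilon> v (axis_vec i \<sigma>) * axes_mass d \<epsilon> (v(i := - v i)) (axis_vec i \<sigma>) = (1 - \<epsilon>^2) / (2 * real d)^2"
          if "\<sigma> = 1 \<or> \<sigma> = -1" for \<sigma> :: real
          using sign_vectors_cases[OF v i] that i
          by (auto simp: axes_mass_axis_vec power2_eq_square algebra_simps)
        then have "?f i \<sigma> = sqrt (1 - \<epsilon>^2) / (2 * real d)" if "\<sigma> = 1 \<or> \<sigma> = -1" for \<sigma> :: real
          using that by (simp add: real_sqrt_divide real_sqrt_mult)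
        then have "?f i (-1) + ?f i 1 = sqrt (1 - \<epsilon>^2) / (2 * real d) + sqrt (1 - \<epsilon>^2) / (2 * real d)"
          by (intro arg_cong2[where f = "(+)"]) auto
        also have "\<dots> = sqrt (1 - \<epsilon>^2) / real d" by simp
        finally have "?f i (-1) + ?f i 1 = sqrt (1 - \<epsilon>^2) / real d" .
        moreover have "(1 - \<epsilon>^2) / real d \<le> sqrt (1 - \<epsilon>^2) / real d"
          by (intro divide_right_mono one_minus_le_sqrt) (use \<epsilon> in \<open>auto simp: power_le_one\<close>)
        ultimately show ?thesis using True by (simp add: diff_divide_distrib)
      next
        case False
        have f: "?f k \<sigma> = (1 + \<epsilon> * \<sigma> * v k) / (2 * real d)" if "0 \<le> 1 + \<epsilon> * \<sigma> * v k" for \<sigma>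
        proof -
          have "axes_mass d \<epsilon> (v(i := - v i)) (axis_vec k \<sigma>) = axes_mass d \<epsilon> v (axis_vec k \<sigma>)"
            using False k by (simp add: axes_mass_axis_vec)
          then have "?f k \<sigma> = \<bar>axes_mass d \<epsilon> v (axis_vec k \<sigma>)\<bar>" by (simp only: real_sqrt_abs2)
          then show ?thesis using k that by (simp add: axes_mass_axis_vec)
        qed
        have "1 + \<epsilon> * v k \<ge> 0" "1 - \<epsilon> * v k \<ge> 0"
          using sign_vectors_cases[OF v k] \<epsilon> by auto
        then have "?f k (-1) = (1 - \<epsilon> * v k) / (2 * real d)" "?f k 1 = (1 + \<epsilon> * v k) / (2 * real d)"
          using f[of "-1"] f[of 1] by simp_all
        then have "?f k (-1) + ?f k 1 = 1 / real d"
          by (simp only: add_divide_distrib[symmetric]) simp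
        then show ?thesis using False by simp
      qed
    qed
    moreover have "(\<Sum>k<d. 1 / real d - (if k = i then \<epsilon>^2 / real d else 0)) = 1 - 1 / real d * \<epsilon>^2"
      using d i by (simp add: sum_subtractf)
    ultimately show ?thesis unfolding sum_signed_axes by simp
  qed
  show "lp_norm d p g \<le> G" if s: "s \<in> signed_axes d"
    and g: "\<And>i. i < d \<Longrightarrow> \<bar>g i\<bar> \<le> (if s i = -1 \<or> s i = 1 then G else 0)" for s g
  proof -
    from s obtain k \<sigma> where k: "k < d" "\<sigma> \<in> {-1, 1}" "s = axis_vec k \<sigma>"
      by (auto simp: signed_axes_def)
    show ?thesis
    proof (rule lp_norm_le_single[OF k(1) p])
      show "g i = 0" if "i < d" "i \<noteq> k" for i
        using g[OF that(1)] that k by (simp add: axis_vec_def)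
      show "\<bar>g k\<bar> \<le> G" using g[OF k(1)] k by (auto simp: axis_vec_def)
    qed
  qed
  show "G * (1 / real d) * (\<Sum>i<d. \<bar>z i\<bar>) \<le> G * lp_norm d q z" for z
  proof -
    have "(\<Sum>i<d. \<bar>z i\<bar>) \<le> real d powr (1 - enn2real (1 / q)) * lp_norm d q z"
      by (rule sum_abs_le_lp_norm[OF d conjugate_exponent(2)[OF pq]])
    also have "\<dots> \<le> real d powr 1 * lp_norm d q z"
    proof (intro mult_right_mono powr_mono)
      have "0 \<le> \<bar>z 0\<bar>" by simp
      also have "\<bar>z 0\<bar> \<le> (MAX i\<in>{..<d}. \<bar>z i\<bar>)" using d by (intro Max_ge) auto
      finally show "0 \<le> lp_norm d q z" by (simp add: lp_norm_def)
    qed (use d in auto)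
    finally have "1 / real d * (\<Sum>i<d. \<bar>z i\<bar>) \<le> lp_norm d q z"
      using d by (simp add: field_simps)
    then have "G * (1 / real d * (\<Sum>i<d. \<bar>z i\<bar>)) \<le> G * lp_norm d q z"
      by (rule mult_left_mono) (use G in simp)
    then show ?thesis by (simp only: mult.assoc)
  qed
qed (use d r X \<epsilon> G in auto)

section \<open>Choice of the bias and final rates\<close>

text \<open>The bias depends on \<open>T\<close>, so the instance is required for every
  \<open>\<epsilon>\<close>. The choice \<open>\<epsilon> = 1 / (2 * sqrt (n * \<rho>))\<close>
  gives equality in the smallness condition of \<open>minimax_error_ge\<close>;
  \<open>T \<ge> \<tau> * d\<close> and \<open>\<rho> * d \<ge> 1\<close> give
  \<open>n * \<rho> \<ge> 1\<close>, which keeps \<open>\<epsilon>\<close> at most 1.\<close>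

lemma minimax_error_rate:
  assumes inst: "\<And>\<epsilon>. 0 \<le> \<epsilon> \<Longrightarrow> \<epsilon> \<le> 1 \<Longrightarrow> hard_instance d X S (m \<epsilon>) \<rho> \<epsilon> A r G p q"
    and \<rho>: "\<rho> > 0" "\<rho> * real d \<ge> 1" and \<tau>: "\<tau> \<ge> 1" and T: "T \<ge> \<tau> * d" and d: "d \<ge> 1"
  shows "ennreal (real d * A * sqrt \<rho> * r * sqrt (real \<tau> / real T) / 24)
    \<le> minimax_error (convex_lipschitz d X G q) d X \<tau> G p T"
proof -
  define n where "n = (T - 1) div \<tau> + 1"
  define \<epsilon> where "\<epsilon> = 1 / (2 * sqrt (real n * \<rho>))"
  have T\<tau>: "T \<ge> \<tau>" using T d by (metis le_trans mult.right_neutral mult_le_mono2)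
  then have T1: "T \<ge> 1" using \<tau> by simp
  have "T \<le> n * \<tau>"
  proof -
    have "T - 1 < ((T - 1) div \<tau> + 1) * \<tau>"
      using \<tau> by (metis Suc_eq_plus1 dividend_less_div_times less_le_trans mult_Suc zero_less_one add.commute)
    then show ?thesis using T1 by (simp add: n_def)
  qed
  with T have "\<tau> * d \<le> n * \<tau>" by (rule le_trans)
  then have "\<tau> * d \<le> \<tau> * n" by (simp only: mult.commute)
  then have "d \<le> n" using \<tau> by simp
  then have "real d * \<rho> \<le> real n * \<rho>" using \<rho> by (intro mult_right_mono) auto
  then have n\<rho>: "real n * \<rho> \<ge> 1" using \<rho>(2) by (simp only: mult.commute[of \<rho>])
  then have sq: "sqrt (real n * \<rho>) \<ge> 1" by simp
  have "0 \<le> 1 / (2 * c)" "1 / (2 * c) \<le> 1" if "c \<ge> 1" for c :: real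
    using that by (simp_all add: divide_le_eq)
  from this[OF sq] have \<epsilon>: "0 \<le> \<epsilon>" "\<epsilon> \<le> 1" unfolding \<epsilon>_def .
  interpret hard_instance d X S "m \<epsilon>" \<rho> \<epsilon> A r G p q by (rule inst[OF \<epsilon>])
  have "\<epsilon>^2 = 1 / (4 * (real n * \<rho>))"
    unfolding \<epsilon>_def using n\<rho> by (simp add: power_divide power_mult_distrib)
  then have small: "real n * (\<rho> * \<epsilon>^2) \<le> 1 / 4"
    using n\<rho> by (auto simp: field_simps)
  \<comment> \<open>Rounding \<open>T / \<tau>\<close> up to \<open>n\<close> costs at most a factor
    2, because \<open>T \<ge> \<tau>\<close>.\<close>
  have "(T - 1) div \<tau> * \<tau> \<le> T - 1" by simp
  then have "n * \<tau> \<le> 2 * T"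
    unfolding n_def add_mult_distrib mult_1 using T\<tau> T1 by linarith
  then have "real n * real \<tau> \<le> 2 * real T"
    by (metis of_nat_le_iff of_nat_mult of_nat_numeral)
  then have "real \<tau> / real T \<le> 2 / real n"
    using T1 n_def by (simp add: field_simps)
  \<comment> \<open>Weakening 2 to 4 makes the root exact. The constant 1/24 is 1/6 from
    \<open>minimax_error_ge\<close>, 1/2 from \<open>\<epsilon>\<close> and 1/2 from this
    root.\<close>
  also have "\<dots> \<le> 4 / real n" by (simp add: divide_right_mono)
  finally have "sqrt (real \<tau> / real T) \<le> sqrt (4 / real n)" by (rule real_sqrt_le_mono)
  also have "\<dots> = 2 / sqrt (real n)" by (simp add: real_sqrt_divide)
  finally have sq_le: "sqrt (real \<tau> / real T) \<le> 2 / sqrt (real n)" .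
  have "real d * A * sqrt \<rho> * r * sqrt (real \<tau> / real T) / 24 \<le> real d * A * sqrt \<rho> * r * (2 / sqrt (real n)) / 24"
    using A r \<rho> by (intro divide_right_mono mult_left_mono sq_le) auto
  also have "\<dots> = real d * (A * \<rho> * r * \<epsilon>) / 6"
  proof -
    have "\<rho> * \<epsilon> = sqrt \<rho> / (2 * sqrt (real n))"
      unfolding \<epsilon>_def real_sqrt_mult using \<rho>(1)
      by (simp add: real_div_sqrt divide_simps)
    then have "real d * (A * \<rho> * r * \<epsilon>) / 6 = real d * A * r * (sqrt \<rho> / (2 * sqrt (real n))) / 6"
      by (metis (no_types, opaque_lifting) mult.assoc mult.left_commute)
    then show ?thesis by simp
  qed
  finally show ?thesis
    by (intro order.trans[OF ennreal_leI minimax_error_ge[OF \<tau> T1 n_def small]])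
qed

theorem theorem4:
  shows "\<exists>c::real. c > 0 \<and>
    (\<forall>(d::nat) (X :: rvector set) (r::real) (p::ennreal) (q::ennreal) (G::real) (\<tau>::nat).
       d \<ge> 1 \<longrightarrow> X \<subseteq> rvec d \<longrightarrow> convex X \<longrightarrow>
       r > 0 \<longrightarrow> {x \<in> rvec d. lp_norm d \<infinity> x \<le> r} \<subseteq> X \<longrightarrow>
       p \<ge> 1 \<longrightarrow> 1 / p + 1 / q = 1 \<longrightarrow> G > 0 \<longrightarrow> \<tau> \<ge> 1 \<longrightarrow>
       (p \<le> 2 \<longrightarrow>
          (\<exists>N. \<forall>T\<ge>N. minimax_error (convex_lipschitz d X G q) d X \<tau> G p T \<ge>
             ennreal (c * (G * r * sqrt (real d) * sqrt (real \<tau> / real T))))) \<and>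
       (p \<ge> 2 \<longrightarrow>
          (\<exists>N. \<forall>T\<ge>N. minimax_error (convex_lipschitz d X G q) d X \<tau> G p T \<ge>
             ennreal (c * (G * r * real d powr enn2real (1 / q) * sqrt (real \<tau> / real T))))))"
proof (intro exI[of _ "1 / 24"] conjI allI impI)
  fix d :: nat and X :: "rvector set" and r :: real and p q :: ennreal and G :: real and \<tau> :: nat
  assume d: "d \<ge> 1" and X: "X \<subseteq> rvec d" "{x \<in> rvec d. lp_norm d \<infinity> x \<le> r} \<subseteq> X" and r: "r > 0"
    and p: "p \<ge> 1" and pq: "1 / p + 1 / q = 1" and G: "G > 0" and \<tau>: "\<tau> \<ge> 1"
  \<comment> \<open>With \<open>A = G\<close> and \<open>\<rho> = 1 / d\<close> the factor
    \<open>d * A * sqrt \<rho>\<close> equals \<open>G * sqrt d\<close>.\<close>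
  have eq: "1 / 24 * (G * r * sqrt (real d) * sqrt (real \<tau> / real T))
      = real d * G * sqrt (1 / real d) * r * sqrt (real \<tau> / real T) / 24" for T
  proof -
    have "real d * sqrt (1 / real d) = sqrt (real d)"
      by (simp add: real_sqrt_divide real_div_sqrt)
    then have "real d * G * sqrt (1 / real d) * r = G * r * sqrt (real d)"
      by (metis (no_types, opaque_lifting) mult.assoc mult.commute)
    then show ?thesis by (simp only:)
  qed
  show "\<exists>N. \<forall>T\<ge>N. minimax_error (convex_lipschitz d X G q) d X \<tau> G p T \<ge>
      ennreal (1 / 24 * (G * r * sqrt (real d) * sqrt (real \<tau> / real T)))"
  proof (intro exI allI impI)
    \<comment> \<open>The threshold is \<open>\<tau> * d\<close>, from which on there are at least
      \<open>d\<close> blocks.\<close>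
    fix T assume T: "T \<ge> \<tau> * d"
    show "minimax_error (convex_lipschitz d X G q) d X \<tau> G p T \<ge>
        ennreal (1 / 24 * (G * r * sqrt (real d) * sqrt (real \<tau> / real T)))"
      unfolding eq
      by (rule minimax_error_rate[OF hard_instance_axes[OF d r X _ _ G p pq] _ _ \<tau> T d]) (use d in simp_all)
  qed
  \<comment> \<open>For the first family \<open>\<rho> = 1\<close>, and the power of
    \<open>d\<close> in \<open>d * A\<close> is 1 - 1/p = 1/q.\<close>
  have "real d * (G * real d powr (- enn2real (1 / p))) = G * real d powr enn2real (1 / q)"
  proof -
    have "enn2real (1 / q) = 1 + (- enn2real (1 / p))"
      using conjugate_exponent(1)[OF pq] by simp
    then show ?thesis using d by (simp only: powr_add) simp
  qed
  then have eq': "1 / 24 * (G * r * real d powr enn2real (1 / q) * sqrt (real \<tau> / real T))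
      = real d * (G * real d powr (- enn2real (1 / p))) * sqrt 1 * r * sqrt (real \<tau> / real T) / 24" for T
    by (simp only:) simp
  show "\<exists>N. \<forall>T\<ge>N. minimax_error (convex_lipschitz d X G q) d X \<tau> G p T \<ge>
      ennreal (1 / 24 * (G * r * real d powr enn2real (1 / q) * sqrt (real \<tau> / real T)))"
  proof (intro exI allI impI)
    fix T assume T: "T \<ge> \<tau> * d"
    show "minimax_error (convex_lipschitz d X G q) d X \<tau> G p T \<ge>
        ennreal (1 / 24 * (G * r * real d powr enn2real (1 / q) * sqrt (real \<tau> / real T)))"
      unfolding eq'
      by (rule minimax_error_rate[OF hard_instance_cube[OF d r X _ _ G p pq] _ _ \<tau> T d]) (use d in simp_all)
  qed
qed simp

end
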